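(* If $t\ge 2$, $n\ge 20t^2-t$ and $\pi=(d_1,\ldots,d_n)$ is a graphic sequence with $\sigma(\pi)>4tn-2n-4t^2+2t$, then $\pi$ has a realization containing every 2-tree on $3t$ vertices as a subgraph.
   Context: A simple graph $G$ is a 2-tree if $G=K_3$, or $G$ has a vertex $v$ of degree 2 whose two neighbors are adjacent and $G-v$ is a 2-tree. A non-increasing sequence $\pi=(d_1,\ldots,d_n)$ of nonnegative integers is graphic if it is the degree sequence of some simple graph on $n$ vertices, called a realization of $\pi$. We write $\sigma(\pi)=d_1+\cdots+d_n$. *)

theory Defs
  imports "Graph_Theory.Graph_Theory" "HOL-Library.Multiset"
begin

text \<open>
  Finite simple graphs are \<^const>\<open>graph\<close>s: symmetric loop-free digraphs without parallel arcs.
  Each edge is a pair of opposite arcs, so the degree of a vertex is its \<^const>\<open>out_degree\<close>.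
\<close>

inductive two_tree :: "('a, 'b) pre_digraph \<Rightarrow> bool" where
  K3: "complete_digraph 3 G \<Longrightarrow> two_tree G"
| step: "\<lbrakk>graph G; v \<in> verts G; out_degree G v = 2;
    v \<rightarrow>\<^bsub>G\<^esub> x; v \<rightarrow>\<^bsub>G\<^esub> y; x \<noteq> y; x \<rightarrow>\<^bsub>G\<^esub> y;
    two_tree (pre_digraph.del_vert G v)\<rbrakk> \<Longrightarrow> two_tree G"

definition realization :: "('a, 'b) pre_digraph \<Rightarrow> nat list \<Rightarrow> bool" where
  "realization G \<pi> \<longleftrightarrow> graph G \<and> image_mset (out_degree G) (mset_set (verts G)) = mset \<pi>"

text \<open>
  Every finite simple graph is isomorphic to one with vertices of type \<^typ>\<open>nat\<close> and arcs that
  are pairs of vertices, so it suffices to consider these.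
\<close>

definition graphic :: "nat list \<Rightarrow> bool" where
  "graphic \<pi> \<longleftrightarrow> sorted_wrt (\<ge>) \<pi> \<and> (\<exists>G :: nat pair_pre_digraph. realization (with_proj G) \<pi>)"

definition contains_subgraph :: "('a, 'b) pre_digraph \<Rightarrow> ('c, 'd) pre_digraph \<Rightarrow> bool" where
  "contains_subgraph G T \<longleftrightarrow> (\<exists>H. subgraph H G \<and> digraph_iso T H)"

end

theory Submission
  imports Defs
begin

text \<open>
  A 2-tree has a proper 3-colouring in which any two colour classes induce a forest. Hence, for
  \<open>j \<le> t\<close>, all but \<open>2t - j\<close> of its \<open>3t\<close> vertices can be chosen to span only a bipartite graph
  with parts \<open>W\<close>, \<open>Q\<close> of total size \<open>2j\<close>, plus isolated vertices. So one graph \<open>U\<close> on \<open>3t\<close> vertices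
  contains all 2-trees: a clique of \<open>2t - j\<close> hubs, joined to a graph on \<open>t + j\<close> vertices with only
  \<open>2j\<close> non-isolated ones, where \<open>j = 1\<close> if at least \<open>2t - 1\<close> degrees are at least \<open>3t - 1\<close>, and
  otherwise \<open>2t - j\<close> is the number of such degrees.

  Place \<open>U\<close> on the vertices of largest degree and take a realization \<open>E\<close> sharing as many edges with
  \<open>U\<close> as possible. Suppose \<open>uv\<close> is an edge of \<open>U\<close> outside \<open>E\<close>. Both ends have neighbours \<open>x\<close>, \<open>y\<close>
  along edges outside \<open>U\<close>, and no switch \<open>- ux - vy - zw + uv + xz + yw\<close> is possible, so every edge
  \<open>zw\<close> outside \<open>U\<close> meets the closed neighbourhoods of \<open>x\<close> and \<open>y\<close>. If these are small, there are too
  few edges for the given degree sum. If they are large, the blocked switches make one of the sets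
  of such neighbours a clique, and already a clique on \<open>3t\<close> vertices contains all 2-trees.
\<close>

section \<open>Edge switches\<close>

definition simple_graph_on :: "'a set \<Rightarrow> ('a \<times> 'a) set \<Rightarrow> bool" where
  "simple_graph_on V E \<longleftrightarrow> finite V \<and> E \<subseteq> V \<times> V \<and> sym E \<and> irrefl E"

lemma simple_graph_onD:
  assumes "simple_graph_on V E"
  shows "finite V" "finite E" "E \<subseteq> V \<times> V" "sym E" "irrefl E" "finite (E `` A)"
    "(x, y) \<in> E \<Longrightarrow> (y, x) \<in> E" "(x, x) \<notin> E" "(x, y) \<in> E \<Longrightarrow> x \<in> V \<and> y \<in> V"
proof -
  show *: "finite V" "E \<subseteq> V \<times> V" "sym E" "irrefl E"
    using assms by (auto simp: simple_graph_on_def)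
  then show "finite E" by (meson finite_SigmaI finite_subset)
  then show "finite (E `` A)" by auto
  show "(x, y) \<in> E \<Longrightarrow> (y, x) \<in> E" "(x, x) \<notin> E" "(x, y) \<in> E \<Longrightarrow> x \<in> V \<and> y \<in> V"
    using * by (auto simp: irrefl_def dest: symD)
qed

definition add_edge :: "'a \<Rightarrow> 'a \<Rightarrow> ('a \<times> 'a) set \<Rightarrow> ('a \<times> 'a) set" where
  "add_edge p q E = insert (p, q) (insert (q, p) E)"

definition del_edge :: "'a \<Rightarrow> 'a \<Rightarrow> ('a \<times> 'a) set \<Rightarrow> ('a \<times> 'a) set" where
  "del_edge p q E = E - {(p, q), (q, p)}"

text \<open>The change of \<open>card (E \<inter> S)\<close> when the edge pq is added. With
  \<open>S = {w} \<times> UNIV\<close> this is the change of the degree of w, with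
  \<open>S = U\<close> the change of the overlap to be maximized.\<close>

definition hits :: "('a \<times> 'a) set \<Rightarrow> 'a \<Rightarrow> 'a \<Rightarrow> int" where
  "hits S p q = of_bool ((p, q) \<in> S) + of_bool ((q, p) \<in> S)"

lemma simple_graph_on_add_edge:
  "simple_graph_on V E \<Longrightarrow> p \<in> V \<Longrightarrow> q \<in> V \<Longrightarrow> p \<noteq> q \<Longrightarrow> simple_graph_on V (add_edge p q E)"
  by (auto simp: simple_graph_on_def add_edge_def irrefl_def sym_def)

lemma simple_graph_on_del_edge:
  "simple_graph_on V E \<Longrightarrow> simple_graph_on V (del_edge p q E)"
  by (auto simp: simple_graph_on_def del_edge_def irrefl_def sym_def)

lemma card_add_edge_Int:
  assumes "simple_graph_on V E" "(p, q) \<notin> E" "p \<noteq> q"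
  shows "int (card (add_edge p q E \<inter> S)) = int (card (E \<inter> S)) + hits S p q"
proof -
  have "(q, p) \<notin> E" "finite E" using assms simple_graph_onD by metis+
  with assms(2,3) show ?thesis
    by (auto simp: add_edge_def hits_def Int_insert_left)
qed

lemma card_del_edge_Int:
  assumes "simple_graph_on V E" "(p, q) \<in> E"
  shows "int (card (del_edge p q E \<inter> S)) = int (card (E \<inter> S)) - hits S p q"
proof -
  have "p \<noteq> q" "p \<in> V" "q \<in> V" "(q, p) \<in> E" using assms simple_graph_onD by metis+
  moreover from this have "add_edge p q (del_edge p q E) = E"
    using assms(2) by (auto simp: add_edge_def del_edge_def)
  ultimately show ?thesis
    using card_add_edge_Int[OF simple_graph_on_del_edge[OF assms(1)], of p q p q S]
    by (simp add: del_edge_def)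
qed

lemma card_Image_singleton: "card (E `` {v}) = card (E \<inter> {v} \<times> UNIV)"
proof -
  have "snd ` (E \<inter> {v} \<times> UNIV) = E `` {v}" by force
  moreover have "inj_on snd (E \<inter> {v} \<times> UNIV)" by (auto simp: inj_on_def)
  ultimately show ?thesis by (metis card_image)
qed

lemma hits_sym: "sym U \<Longrightarrow> hits U p q = 2 * of_bool ((p, q) \<in> U)"
  by (auto simp: hits_def dest: symD)

lemma two_switch:
  assumes E: "simple_graph_on V E"
    and ux: "(u, x) \<in> E" and vy: "(v, y) \<in> E"
    and uv: "(u, v) \<notin> E" "u \<noteq> v" and xy: "(x, y) \<notin> E" "x \<noteq> y"
  obtains E' where "simple_graph_on V E'" "\<And>v. card (E' `` {v}) = card (E `` {v})"
    "\<And>S. int (card (E' \<inter> S)) = int (card (E \<inter> S)) + hits S u v + hits S x y - hits S u x - hits S v y"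
proof -
  note D = simple_graph_onD[OF E]
  define E1 where "E1 = del_edge u x E"
  define E2 where "E2 = del_edge v y E1"
  define E3 where "E3 = add_edge u v E2"
  define E4 where "E4 = add_edge x y E3"
  note defs = E1_def E2_def E3_def E4_def
  have V: "u \<in> V" "v \<in> V" "x \<in> V" "y \<in> V" using D ux vy by blast+
  have S1: "simple_graph_on V E1" "simple_graph_on V E2" "simple_graph_on V E3" "simple_graph_on V E4"
    unfolding defs using E V uv xy by (blast intro: simple_graph_on_add_edge simple_graph_on_del_edge)+
  have "(v, y) \<in> E1" using vy ux uv D by (auto simp: E1_def del_edge_def)
  moreover have "(u, v) \<notin> E2" using uv by (auto simp: E2_def E1_def del_edge_def)
  moreover have "(x, y) \<notin> E3" using xy uv ux vy D
    by (auto simp: E3_def E2_def E1_def del_edge_def add_edge_def)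
  ultimately have *: "int (card (E4 \<inter> S)) =
      int (card (E \<inter> S)) + hits S u v + hits S x y - hits S u x - hits S v y" for S
    using card_del_edge_Int[OF E ux, of S] card_del_edge_Int[OF S1(1), of v y S]
      card_add_edge_Int[OF S1(2), of u v S] card_add_edge_Int[OF S1(3), of x y S] uv xy
    by (simp add: E1_def[symmetric] E2_def[symmetric] E3_def[symmetric] E4_def[symmetric])
  \<comment> \<open>For \<open>S = {w} \<times> UNIV\<close> the gained and lost terms cancel: each
    of u, v, x, y occurs in one added and one removed edge.\<close>
  have "card (E4 `` {w}) = card (E `` {w})" for w
    using *[of "{w} \<times> UNIV"] by (simp add: card_Image_singleton hits_def)
  with * S1(4) show thesis by (intro that)
qed

text \<open>Coincidences among the six vertices need no separate hypotheses: every one that would make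
  two removed or two added edges equal contradicts the assumed edges and non-edges.\<close>

lemma three_switch:
  assumes E: "simple_graph_on V E"
    and ux: "(u, x) \<in> E" and vy: "(v, y) \<in> E" and zw: "(z, w) \<in> E"
    and uv: "(u, v) \<notin> E" "u \<noteq> v" and xz: "(x, z) \<notin> E" "x \<noteq> z" and yw: "(y, w) \<notin> E" "y \<noteq> w"
  obtains E' where "simple_graph_on V E'" "\<And>v. card (E' `` {v}) = card (E `` {v})"
    "\<And>S. int (card (E' \<inter> S)) = int (card (E \<inter> S)) + hits S u v + hits S x z + hits S y w
      - hits S u x - hits S v y - hits S z w"
proof -
  note D = simple_graph_onD[OF E]
  define E1 where "E1 = del_edge u x E"
  define E2 where "E2 = del_edge v y E1"
  define E3 where "E3 = del_edge z w E2"
  define E4 where "E4 = add_edge u v E3"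
  define E5 where "E5 = add_edge x z E4"
  define E6 where "E6 = add_edge y w E5"
  note defs = E1_def E2_def E3_def E4_def E5_def E6_def
  have V: "u \<in> V" "v \<in> V" "x \<in> V" "y \<in> V" "z \<in> V" "w \<in> V" using D ux vy zw by blast+
  have S1: "simple_graph_on V E1" "simple_graph_on V E2" "simple_graph_on V E3"
    "simple_graph_on V E4" "simple_graph_on V E5" "simple_graph_on V E6"
    unfolding defs using E V uv xz yw by (blast intro: simple_graph_on_add_edge simple_graph_on_del_edge)+
  have "(v, y) \<in> E1" using vy ux uv D by (auto simp: E1_def del_edge_def)
  moreover have "(z, w) \<in> E2" using vy ux uv zw xz yw D(7,8)
    by (auto simp: E2_def E1_def del_edge_def)
  moreover have "(u, v) \<notin> E3" using uv by (auto simp: E3_def E2_def E1_def del_edge_def)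
  moreover have "(x, z) \<notin> E4" using xz uv ux D(7,8)
    by (auto simp: E4_def E3_def E2_def E1_def del_edge_def add_edge_def)
  moreover have "(y, w) \<notin> E5" using xz uv ux vy zw yw D(7,8)
    by (auto simp: E5_def E4_def E3_def E2_def E1_def del_edge_def add_edge_def)
  ultimately have *: "int (card (E6 \<inter> S)) = int (card (E \<inter> S)) + hits S u v + hits S x z + hits S y w
      - hits S u x - hits S v y - hits S z w" for S
    using card_del_edge_Int[OF E ux, of S] card_del_edge_Int[OF S1(1), of v y S]
      card_del_edge_Int[OF S1(2), of z w S] card_add_edge_Int[OF S1(3), of u v S]
      card_add_edge_Int[OF S1(4), of x z S] card_add_edge_Int[OF S1(5), of y w S] uv xz yw
    by (simp add: E1_def[symmetric] E2_def[symmetric] E3_def[symmetric] E4_def[symmetric]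
        E5_def[symmetric] E6_def[symmetric])
  have "card (E6 `` {w}) = card (E `` {w})" for w
    using *[of "{w} \<times> UNIV"] by (simp add: card_Image_singleton hits_def)
  with * S1(6) show thesis by (intro that)
qed

section \<open>Realizations with maximal overlap with a target graph\<close>

definition realizes :: "'a set \<Rightarrow> ('a \<Rightarrow> nat) \<Rightarrow> ('a \<times> 'a) set \<Rightarrow> bool" where
  "realizes V d E \<longleftrightarrow> simple_graph_on V E \<and> (\<forall>v\<in>V. card (E `` {v}) = d v)"

locale maximal_realization =
  fixes V :: "'a set" and d :: "'a \<Rightarrow> nat" and U E :: "('a \<times> 'a) set"
  assumes realizes: "realizes V d E"
    and sym_U: "sym U"
    and maximal: "\<And>E'. realizes V d E' \<Longrightarrow> card (E' \<inter> U) \<le> card (E \<inter> U)"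
begin

lemma simple: "simple_graph_on V E"
  and deg: "v \<in> V \<Longrightarrow> card (E `` {v}) = d v"
  using realizes by (auto simp: realizes_def)

lemmas fin_E = simple_graph_onD(2)[OF simple]
  and fin_nbrs [simp] = simple_graph_onD(6)[OF simple]
  and edge_sym = simple_graph_onD(7)[OF simple]
  and no_loop [simp] = simple_graph_onD(8)[OF simple]
  and edge_in = simple_graph_onD(9)[OF simple]

lemma U_sym: "(x, y) \<in> U \<Longrightarrow> (y, x) \<in> U"
  using sym_U by (rule symD)

text \<open>The switch \<open>- ux - vy + uv + xy\<close> would gain the edge uv of U and lose no
  edge of U, against maximality.\<close>

lemma two_switch_blocked:
  assumes "(u, v) \<in> U - E" "u \<noteq> v" "(u, x) \<in> E - U" "(v, y) \<in> E - U"
  shows "(x, y) \<in> E \<or> x = y"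
proof (rule ccontr)
  assume "\<not> ?thesis"
  with assms obtain E' where E': "simple_graph_on V E'" "\<And>v. card (E' `` {v}) = card (E `` {v})"
    and h: "\<And>S. int (card (E' \<inter> S)) = int (card (E \<inter> S)) + hits S u v + hits S x y - hits S u x - hits S v y"
    using two_switch[OF simple, of u x v y] by blast
  from E' have "realizes V d E'" using realizes by (simp add: realizes_def)
  from maximal[OF this] h[of U] assms show False
    by (simp add: hits_sym[OF sym_U] of_bool_def split: if_splits)
qed

text \<open>The third removed edge zw may even lie in U, provided that the added edge yw lies in U
  too and makes up for it.\<close>

lemma three_switch_blocked:
  assumes "(u, v) \<in> U - E" "u \<noteq> v" "(u, x) \<in> E - U" "(v, y) \<in> E - U"
    and "(z, w) \<in> E" "(z, w) \<notin> U \<or> (y, w) \<in> U"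
  shows "(x, z) \<in> E \<or> x = z \<or> (y, w) \<in> E \<or> y = w"
proof (rule ccontr)
  assume "\<not> ?thesis"
  with assms obtain E' where E': "simple_graph_on V E'" "\<And>v. card (E' `` {v}) = card (E `` {v})"
    and h: "\<And>S. int (card (E' \<inter> S)) = int (card (E \<inter> S)) + hits S u v + hits S x z + hits S y w
      - hits S u x - hits S v y - hits S z w"
    using three_switch[OF simple, of u x v y z w] by blast
  from E' have "realizes V d E'" using realizes by (simp add: realizes_def)
  from maximal[OF this] h[of U] assms show False
    by (auto simp: hits_sym[OF sym_U] of_bool_def split: if_splits)
qed

definition excess :: "'a \<Rightarrow> 'a set" where
  "excess u = E `` {u} - U `` {u}"

lemma excess_iff: "x \<in> excess u \<longleftrightarrow> (u, x) \<in> E - U"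
  by (auto simp: excess_def)

lemma finite_excess [simp]: "finite (excess u)"
  by (simp add: excess_def)

text \<open>In the three-edge switch with \<open>zw = x'u\<close>, u trades x and x' for v and y. As
  uy is a non-edge, only the edge xx' can block it.\<close>

lemma excess_clique:
  assumes "(u, v) \<in> U - E" "u \<noteq> v" "y \<in> excess v" "(u, y) \<notin> E" "x \<in> excess u" "x' \<in> excess u" "x \<noteq> x'"
  shows "(x, x') \<in> E"
proof -
  have "(x', u) \<in> E" "(x', u) \<notin> U" "y \<noteq> u"
    using assms edge_sym U_sym by (auto simp: excess_iff)
  then show ?thesis
    using three_switch_blocked[of u v x y x' u] assms edge_sym by (auto simp: excess_iff)
qed

lemma common_excess_clique:
  assumes "(u, v) \<in> U - E" "u \<noteq> v" "x \<in> excess u \<inter> excess v" "x' \<in> excess u \<inter> excess v" "x \<noteq> x'"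
  shows "(x, x') \<in> E"
  using two_switch_blocked[of u v x x'] assms by (auto simp: excess_iff)

text \<open>The summand 1 accounts for v, a neighbour of u in U but not in E.\<close>

lemma deg_le_excess:
  assumes "(u, v) \<in> U - E" "u \<in> V" "finite (U `` {u})"
  shows "d u + 1 \<le> card (excess u) + card (U `` {u})"
proof -
  have "E `` {u} = excess u \<union> (E `` {u} \<inter> U `` {u})" by (auto simp: excess_def)
  then have "d u \<le> card (excess u) + card (E `` {u} \<inter> U `` {u})"
    by (metis card_Un_le deg[OF assms(2)])
  moreover have "card (E `` {u} \<inter> U `` {u}) < card (U `` {u})"
    using assms by (intro psubset_card_mono) auto
  ultimately show ?thesis by linarith
qed

lemma excess_nonempty:
  assumes "(u, v) \<in> U - E" "u \<in> V" "finite (U `` {u})" "card (U `` {u}) \<le> d u"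
  shows "excess u \<noteq> {}"
  using deg_le_excess[OF assms(1-3)] assms(4) by auto

text \<open>If x had all neighbours of v apart from itself, the extra neighbour u would give x the
  larger degree.\<close>

lemma dominating_neighbour:
  assumes "d x \<le> d v" "x \<in> V" "v \<in> V" "(x, u) \<in> E" "(v, u) \<notin> E" "u \<noteq> v"
  obtains p where "(v, p) \<in> E" "(x, p) \<notin> E" "p \<noteq> x"
proof (rule ccontr)
  assume "\<not> thesis"
  then have sub: "E `` {v} - {x} \<subseteq> E `` {x} - {u, v}"
    using that assms(5) by auto
  have "card (E `` {v} - {x}) \<le> card (E `` {x} - {u, v})"
    using sub by (intro card_mono) auto
  moreover have "(v, x) \<in> E \<longleftrightarrow> (x, v) \<in> E" using edge_sym by blast
  moreover have "card (E `` {x} \<inter> {u, v}) \<le> card (E `` {x})" by (intro card_mono) auto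
  ultimately show False
    using assms deg[of x] deg[of v]
    by (cases "(x, v) \<in> E") (auto simp: card_Diff_singleton_if card_Diff_insert Int_insert_right)
qed

end

lemma ex_maximal_realization:
  assumes "realizes V d E0" "sym U"
  obtains E where "maximal_realization V d U E"
proof -
  have "card (E' \<inter> U) < Suc (card (V \<times> V))" if "realizes V d E'" for E'
  proof -
    have "finite V" "E' \<subseteq> V \<times> V" using that by (auto simp: realizes_def simple_graph_on_def)
    then have "card (E' \<inter> U) \<le> card (V \<times> V)" by (intro card_mono) auto
    then show ?thesis by simp
  qed
  then obtain E where "realizes V d E" "\<And>E'. realizes V d E' \<Longrightarrow> card (E' \<inter> U) \<le> card (E \<inter> U)"
    using assms(1) ex_has_greatest_nat[of "realizes V d" E0 "\<lambda>E. card (E \<inter> U)"] by metis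
  with assms(2) show thesis by (intro that[of E]) (auto simp: maximal_realization_def)
qed

section \<open>Double counting of edges and degree sums\<close>

lemma card_Int_Times_sum:
  assumes "finite A" "finite E"
  shows "card (E \<inter> A \<times> B) = (\<Sum>a\<in>A. card (E `` {a} \<inter> B))"
proof -
  have "E \<inter> A \<times> B = (SIGMA a:A. E `` {a} \<inter> B)" by auto
  then show ?thesis using assms by simp
qed

lemma card_Int_Times_swap:
  assumes "sym E"
  shows "card (E \<inter> A \<times> B) = card (E \<inter> B \<times> A)"
proof -
  have "prod.swap ` (E \<inter> A \<times> B) = E \<inter> B \<times> A"
    using assms by (force simp: image_iff dest: symD)
  then show ?thesis by (metis card_image inj_swap inj_on_subset subset_UNIV)
qed

lemma sum_card_non_neighbours:
  assumes "finite A" "finite B" "sym E"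
  shows "(\<Sum>a\<in>A. card (B - E `` {a})) = (\<Sum>b\<in>B. card (A - E `` {b}))"
proof -
  have *: "card (B - E `` {a}) = (\<Sum>b\<in>B. of_bool ((a, b) \<notin> E))" if "finite B" for a and B :: "'a set"
    using that by (auto simp: of_bool_def sum.If_cases intro!: arg_cong[of _ _ card])
  have "(\<Sum>a\<in>A. card (B - E `` {a})) = (\<Sum>b\<in>B. \<Sum>a\<in>A. of_bool ((a, b) \<notin> E))"
    unfolding *[OF assms(2)] by (rule sum.swap)
  also have "\<dots> = (\<Sum>b\<in>B. card (A - E `` {b}))"
    unfolding *[OF assms(1)] by (intro sum.cong refl) (auto dest: symD[OF assms(3)])
  finally show ?thesis .
qed

text \<open>Cardinalities count arcs: an edge inside K is counted twice in
  \<open>E \<inter> K \<times> K\<close>, while a crossing edge is counted only from its end outside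
  K, hence the factor 2.\<close>

lemma realizes_degree_sum_split:
  assumes "realizes V d E" "K \<subseteq> V"
  shows "(\<Sum>v\<in>V. d v) = card (E \<inter> K \<times> K) + 2 * (\<Sum>v\<in>V - K. card (E `` {v} \<inter> K))
    + (\<Sum>v\<in>V - K. card (E `` {v} \<inter> (V - K)))"
    "(\<Sum>v\<in>K. d v) = card (E \<inter> K \<times> K) + (\<Sum>v\<in>V - K. card (E `` {v} \<inter> K))"
    "card (E \<inter> K \<times> K) + card K \<le> card K * card K"
proof -
  have E: "simple_graph_on V E" and deg: "\<And>v. v \<in> V \<Longrightarrow> card (E `` {v}) = d v"
    using assms(1) by (auto simp: realizes_def)
  note D = simple_graph_onD[OF E]
  have K: "finite K" using assms(2) D(1) finite_subset by blast
  have split: "d v = card (E `` {v} \<inter> K) + card (E `` {v} \<inter> (V - K))" if "v \<in> V" for v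
  proof -
    have "E `` {v} = (E `` {v} \<inter> K) \<union> (E `` {v} \<inter> (V - K))" using D(3) by auto
    moreover have "card \<dots> = card (E `` {v} \<inter> K) + card (E `` {v} \<inter> (V - K))"
      using D(6) by (intro card_Un_disjoint) auto
    ultimately show ?thesis using deg[OF that] by simp
  qed
  have "(\<Sum>v\<in>K. d v) = (\<Sum>v\<in>K. card (E `` {v} \<inter> K)) + (\<Sum>v\<in>K. card (E `` {v} \<inter> (V - K)))"
    unfolding sum.distrib[symmetric] using assms(2) split by (intro sum.cong) auto
  also have "(\<Sum>v\<in>K. card (E `` {v} \<inter> (V - K))) = (\<Sum>v\<in>V - K. card (E `` {v} \<inter> K))"
    using card_Int_Times_sum[OF K D(2), of "V - K"] card_Int_Times_sum[of "V - K" E K] D(1,2)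
      card_Int_Times_swap[OF D(4), of K "V - K"] by simp
  finally show *: "(\<Sum>v\<in>K. d v) = card (E \<inter> K \<times> K) + (\<Sum>v\<in>V - K. card (E `` {v} \<inter> K))"
    using card_Int_Times_sum[OF K D(2), of K] by simp
  have "(\<Sum>v\<in>V - K. d v) = (\<Sum>v\<in>V - K. card (E `` {v} \<inter> K)) + (\<Sum>v\<in>V - K. card (E `` {v} \<inter> (V - K)))"
    unfolding sum.distrib[symmetric] using split by (intro sum.cong) auto
  with * show "(\<Sum>v\<in>V. d v) = card (E \<inter> K \<times> K) + 2 * (\<Sum>v\<in>V - K. card (E `` {v} \<inter> K))
    + (\<Sum>v\<in>V - K. card (E `` {v} \<inter> (V - K)))"
    using sum.subset_diff[OF assms(2) D(1), of d] by simp
  have "(\<Sum>v\<in>K. card (E `` {v} \<inter> K) + 1) \<le> (\<Sum>v\<in>K. card K)"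
  proof (rule sum_mono)
    fix v assume "v \<in> K"
    then have "card (E `` {v} \<inter> K) < card K"
      using D(8)[of v] K by (intro psubset_card_mono) auto
    then show "card (E `` {v} \<inter> K) + 1 \<le> card K" by simp
  qed
  then show "card (E \<inter> K \<times> K) + card K \<le> card K * card K"
    using card_Int_Times_sum[OF K D(2), of K] by (simp add: sum.distrib sum_Suc)
qed

text \<open>A weak Erdos-Gallai inequality, with the usual term min(card K, d v) relaxed to d
  v.\<close>

lemma realizes_head_sum:
  assumes "realizes V d E" "K \<subseteq> V"
  shows "(\<Sum>v\<in>K. d v) + card K \<le> card K * card K + (\<Sum>v\<in>V - K. d v)"
proof -
  have "card (E `` {v} \<inter> K) \<le> d v" if "v \<in> V" for v
  proof -
    have "finite (E `` {v})" "card (E `` {v}) = d v"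
      using assms(1) that simple_graph_onD(6)[of V E "{v}"] by (auto simp: realizes_def)
    then show ?thesis using card_mono[of "E `` {v}" "E `` {v} \<inter> K"] by simp
  qed
  then have "(\<Sum>v\<in>V - K. card (E `` {v} \<inter> K)) \<le> (\<Sum>v\<in>V - K. d v)"
    by (intro sum_mono) auto
  then show ?thesis using realizes_degree_sum_split(2,3)[OF assms] by linarith
qed

section \<open>At least \<open>2t - 1\<close> large degrees\<close>

text \<open>The bounds on n and on the degree sum are rearranged so that no subtraction of natural
  numbers occurs.\<close>

locale dense_sequence =
  fixes n t :: nat and d :: "nat \<Rightarrow> nat"
  assumes t2: "2 \<le> t" and n_large: "20 * t\<^sup>2 \<le> n + t"
    and sorted: "\<And>i k. i \<le> k \<Longrightarrow> k < n \<Longrightarrow> d k \<le> d i"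
    and sum_large: "4 * t * n + 2 * t < (\<Sum>i<n. d i) + 2 * n + 4 * t\<^sup>2"
begin

lemma n_ge: "19 * t \<le> n" "3 * t < n"
proof -
  have "20 * t \<le> 20 * t\<^sup>2" using t2 by (simp add: power2_eq_square)
  with n_large show "19 * t \<le> n" "3 * t < n" using t2 by linarith+
qed

lemma sum_large_int: "4 * int t * int n + 2 * int t < int (\<Sum>i<n. d i) + 2 * int n + 4 * int t * int t"
  using sum_large[folded of_nat_less_iff[where ?'a = int]] by (simp add: power2_eq_square del: of_nat_sum)

lemma n_large_int: "20 * int t * int t \<le> int n + int t"
  using n_large[folded of_nat_le_iff[where ?'a = int]] by (simp add: power2_eq_square)

end

text \<open>The universal graph for \<open>j = 1\<close>: a clique on the first \<open>2t - 1\<close> vertices, joined to \<open>t + 1\<close>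
  further ones among which only \<open>2t - 1\<close> and \<open>2t\<close> are adjacent.\<close>

definition hub_join :: "nat \<Rightarrow> (nat \<times> nat) set" where
  "hub_join t = {(i, k). i \<noteq> k \<and> i < 3 * t \<and> k < 3 * t \<and>
    (i < 2 * t - 1 \<or> k < 2 * t - 1 \<or> i \<le> 2 * t \<and> k \<le> 2 * t)}"

text \<open>Cliques on 3t vertices can be excluded here because such a clique already contains every
  graph on 3t vertices; \<open>ex_universal_realization\<close> treats that case separately.\<close>

locale hub_sequence = dense_sequence n t d + maximal_realization "{..<n}" d "hub_join t" E
  for n t :: nat and d :: "nat \<Rightarrow> nat" and E :: "(nat \<times> nat) set" +
  assumes hubs: "3 * t - 1 \<le> d (2 * t - 2)"
    and no_clique: "\<And>C. C \<subseteq> {..<n} \<Longrightarrow> card C = 3 * t \<Longrightarrow> \<exists>x\<in>C. \<exists>y\<in>C. x \<noteq> y \<and> (x, y) \<notin> E"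
begin

abbreviation "U \<equiv> hub_join t"
abbreviation "K \<equiv> {..<2 * t - 1}"
abbreviation "Out \<equiv> {2 * t - 1..<n}"

definition out :: "nat \<Rightarrow> nat" where "out z = card (E `` {z} \<inter> Out)"
definition miss :: "nat \<Rightarrow> nat" where "miss z = card (K - E `` {z})"

lemma V_minus_K: "{..<n} - K = Out" by auto

lemma K_sub: "K \<subseteq> {..<n}" using n_ge by auto

lemma card_K_Int: "card (E `` {z} \<inter> K) + miss z = 2 * t - 1"
proof -
  have "card ((E `` {z} \<inter> K) \<union> (K - E `` {z})) = card (E `` {z} \<inter> K) + miss z"
    unfolding miss_def by (intro card_Un_disjoint) auto
  moreover have "(E `` {z} \<inter> K) \<union> (K - E `` {z}) = K" by auto
  ultimately show ?thesis by simp
qed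

lemma deg_split: "z < n \<Longrightarrow> d z + miss z = 2 * t - 1 + out z"
proof -
  assume z: "z < n"
  have "E `` {z} = (E `` {z} \<inter> K) \<union> (E `` {z} \<inter> Out)" using edge_in by force
  moreover have "card \<dots> = card (E `` {z} \<inter> K) + out z"
    unfolding out_def by (intro card_Un_disjoint) auto
  ultimately show ?thesis using deg[of z] z card_K_Int[of z] by simp
qed

text \<open>The bound on the degree sum is the sum for \<open>2t - 1\<close> vertices joined to everything and no other
  edges; so the edges avoiding the hubs outnumber the non-edges at the hubs.\<close>

lemma out_gt_miss: "2 * (\<Sum>z\<in>Out. miss z) < (\<Sum>z\<in>Out. out z)"
proof -
  have 1: "(\<Sum>z\<in>Out. card (E `` {z} \<inter> K)) + (\<Sum>z\<in>Out. miss z) = (n - (2 * t - 1)) * (2 * t - 1)"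
    unfolding sum.distrib[symmetric] card_K_Int by simp
  note s = realizes_degree_sum_split[OF realizes K_sub, unfolded V_minus_K]
  have "int (\<Sum>z\<in>Out. card (E `` {z} \<inter> K)) + int (\<Sum>z\<in>Out. miss z) = (int n - (2 * int t - 1)) * (2 * int t - 1)"
    using arg_cong[OF 1, of int] n_ge t2 by (simp add: of_nat_diff del: of_nat_sum)
  moreover have "int (card (E \<inter> K \<times> K)) + (2 * int t - 1) \<le> (2 * int t - 1) * (2 * int t - 1)"
    using s(3)[folded of_nat_le_iff[where ?'a = int]] t2 by (simp add: of_nat_diff)
  moreover note sum_large_int
  moreover have "int (\<Sum>i<n. d i) = int (card (E \<inter> K \<times> K)) + 2 * int (\<Sum>z\<in>Out. card (E `` {z} \<inter> K))
    + int (\<Sum>z\<in>Out. out z)"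
    using s(1) unfolding out_def by linarith
  \<comment> \<open>The threshold 4tn - 2n - 4t*t + 2t is exactly (2t - 1)(2t - 2) + 2(2t - 1)(n -
    2t + 1), so all other terms cancel.\<close>
  ultimately have "2 * int (\<Sum>z\<in>Out. miss z) < int (\<Sum>z\<in>Out. out z)"
    by (simp only: algebra_simps)
  then show ?thesis by linarith
qed

text \<open>The sum of the first k degrees exceeds that of the tail by at most k(k - 1), so the
  total is at most k(k - 1) plus twice the tail.\<close>

lemma sum_le_of_small_tail:
  assumes "k \<le> n" "\<And>i. k \<le> i \<Longrightarrow> i < n \<Longrightarrow> d i \<le> c"
  shows "int (\<Sum>i<n. d i) \<le> int k * (int k - 1) + 2 * (int n - int k) * int c"
proof -
  have sub: "{..<k} \<subseteq> {..<n}" using assms(1) by auto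
  have "(\<Sum>i\<in>{..<n} - {..<k}. d i) \<le> (\<Sum>i\<in>{..<n} - {..<k}. c)"
    using assms(2) by (intro sum_mono) auto
  also have "\<dots> = (n - k) * c" using sub by (simp add: card_Diff_subset)
  finally have "int (\<Sum>i\<in>{..<n} - {..<k}. d i) \<le> int ((n - k) * c)"
    by (simp only: of_nat_le_iff)
  then have "int (\<Sum>i\<in>{..<n} - {..<k}. d i) \<le> (int n - int k) * int c"
    using assms(1) by (simp only: of_nat_mult of_nat_diff)
  moreover have "int (\<Sum>i<k. d i) + int k \<le> int k * int k + int (\<Sum>i\<in>{..<n} - {..<k}. d i)"
    using realizes_head_sum[OF realizes sub, folded of_nat_le_iff[where ?'a = int]]
    by (simp only: of_nat_mult of_nat_add card_lessThan)
  moreover have "(\<Sum>i<n. d i) = (\<Sum>i\<in>{..<n} - {..<k}. d i) + (\<Sum>i<k. d i)"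
    using sub by (intro sum.subset_diff) auto
  ultimately show ?thesis by (simp add: algebra_simps del: of_nat_sum)
qed

text \<open>Both ends of the spare edge, 2t - 1 and 2t, have degree 2t in U. If this bound failed,
  the tail estimate would equal the threshold exactly, against the strict hypothesis.\<close>

lemma deg_third: "2 * t \<le> d (2 * t)"
proof (rule ccontr)
  assume "\<not> ?thesis"
  then have "d i \<le> 2 * t - 1" if "2 * t \<le> i" "i < n" for i
    using sorted[of "2 * t" i] that by auto
  then have "int (\<Sum>i<n. d i) \<le> int (2 * t) * (int (2 * t) - 1) + 2 * (int n - int (2 * t)) * int (2 * t - 1)"
    using n_ge by (intro sum_le_of_small_tail) auto
  then show False using sum_large_int t2 by (simp add: of_nat_diff algebra_simps del: of_nat_sum)
qed

text \<open>This is the degree in U of its last vertices. If it failed, the coefficient of n in the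
  degree sum would drop from 4t - 2 to 4t - 4, and 2n outweighs the terms quadratic in t.\<close>

lemma deg_low: "2 * t - 1 \<le> d (3 * t - 1)"
proof (rule ccontr)
  assume "\<not> ?thesis"
  then have "d i \<le> 2 * t - 2" if "3 * t - 1 \<le> i" "i < n" for i
    using sorted[of "3 * t - 1" i] that by auto
  then have "int (\<Sum>i<n. d i) \<le> int (3 * t - 1) * (int (3 * t - 1) - 1)
      + 2 * (int n - int (3 * t - 1)) * int (2 * t - 2)"
    using n_ge by (intro sum_le_of_small_tail) auto
  also have "\<dots> = 4 * (int t * int n) - 4 * int n - 3 * (int t * int t) + 7 * int t - 2"
    using t2 by (simp add: of_nat_diff algebra_simps)
  finally have "int (\<Sum>i<n. d i) \<le> \<dots>" .
  moreover have "2 * int t \<le> int t * int t" using t2 by (intro mult_right_mono) auto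
  ultimately show False using sum_large_int n_large_int t2 unfolding mult.assoc by linarith
qed

section \<open>Missing edges of U, their excess neighbours and cliques\<close>

lemma U_Image:
  assumes "v < 3 * t"
  shows "U `` {v} = (if v < 2 * t - 1 then {..<3 * t} - {v} else if v \<le> 2 * t then {..<2 * t + 1} - {v} else K)"
  using assms t2 by (auto simp: hub_join_def)

lemma card_U_Image:
  assumes "v < 3 * t"
  shows "card (U `` {v}) = (if v < 2 * t - 1 then 3 * t - 1 else if v \<le> 2 * t then 2 * t else 2 * t - 1)"
  unfolding U_Image[OF assms] using assms by simp

lemma finite_U_Image: "finite (U `` {v})"
  by (rule finite_subset[of _ "{..<3 * t}"]) (auto simp: hub_join_def)

lemma deg_ge_U:
  assumes "v < 3 * t"
  shows "card (U `` {v}) \<le> d v"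
proof -
  have "d (3 * t - 1) \<le> d v" using sorted[of v "3 * t - 1"] assms n_ge t2 by auto
  moreover have "d (2 * t) \<le> d v" if "v \<le> 2 * t" using sorted[of v "2 * t"] that n_ge t2 by auto
  moreover have "d (2 * t - 2) \<le> d v" if "v < 2 * t - 1"
    using sorted[of v "2 * t - 2"] that n_ge by auto
  ultimately show ?thesis
    unfolding card_U_Image[OF assms] using hubs deg_third deg_low by (auto split: if_splits)
qed

text \<open>A hole is an edge of U missing from E. Its ends have at least their U-degree in E, so
  the missing edge is compensated by an edge outside U.\<close>

lemma hole_excess:
  assumes "(u, v) \<in> U - E"
  shows "excess u \<noteq> {}" "excess v \<noteq> {}" "u < 3 * t" "v < 3 * t" "u \<noteq> v" "(v, u) \<in> U - E"
proof -
  show *: "u < 3 * t" "v < 3 * t" "u \<noteq> v" "(v, u) \<in> U - E"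
    using assms edge_sym by (auto simp: hub_join_def)
  show "excess u \<noteq> {}" "excess v \<noteq> {}"
    using excess_nonempty[OF assms] excess_nonempty[OF *(4)] * finite_U_Image deg_ge_U n_ge by auto
qed

lemma excess_lt: "x \<in> excess u \<Longrightarrow> x < n"
  using edge_in by (auto simp: excess_iff)

lemma excess_notin_K: "x \<in> excess u \<Longrightarrow> u < 3 * t \<Longrightarrow> 2 * t - 1 \<le> x"
proof (rule ccontr)
  assume "x \<in> excess u" "u < 3 * t" "\<not> 2 * t - 1 \<le> x"
  moreover from this have "(u, x) \<notin> U" "u \<noteq> x" by (auto simp: excess_iff)
  ultimately show False using t2 by (auto simp: hub_join_def)
qed

lemma excess_K: "x \<in> excess u \<Longrightarrow> u < 2 * t - 1 \<Longrightarrow> 3 * t \<le> x"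
proof (rule ccontr)
  assume "x \<in> excess u" "u < 2 * t - 1" "\<not> 3 * t \<le> x"
  moreover from this have "(u, x) \<notin> U" "u \<noteq> x" by (auto simp: excess_iff)
  ultimately show False using t2 by (auto simp: hub_join_def)
qed

text \<open>Together with u, a clique of 3t - 1 excess neighbours would be a clique on 3t
  vertices.\<close>

lemma card_excess_clique:
  assumes "\<And>x x'. x \<in> excess u \<Longrightarrow> x' \<in> excess u \<Longrightarrow> x \<noteq> x' \<Longrightarrow> (x, x') \<in> E" "u < n"
  shows "card (excess u) \<le> 3 * t - 2"
proof (rule ccontr)
  assume "\<not> ?thesis"
  then have "3 * t - 1 \<le> card (excess u)" by simp
  then obtain C where C: "C \<subseteq> excess u" "card C = 3 * t - 1" "finite C"
    using obtain_subset_with_card_n by metis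
  have "u \<notin> C" using C by (auto simp: excess_iff)
  with C t2 have "card (insert u C) = 3 * t" by simp
  moreover have "insert u C \<subseteq> {..<n}" using C assms(2) excess_lt by auto
  moreover have "(u, x) \<in> E" "(x, u) \<in> E" if "x \<in> C" for x using that C edge_sym by (auto simp: excess_iff)
  ultimately show False using no_clique[of "insert u C"] assms(1) C by blast
qed

text \<open>If some y in the excess of v is not adjacent to u, the excess of u is a clique by
  \<open>excess_clique\<close>. Otherwise the excess of v consists of common excess neighbours and
  is itself a clique.\<close>

lemma excess_clique_dichotomy:
  assumes "(u, v) \<in> U - E"
    and "\<And>y. y \<in> excess v \<Longrightarrow> (u, y) \<in> E \<Longrightarrow> y \<in> excess u"
  shows "card (excess u) \<le> 3 * t - 2 \<or> card (excess v) \<le> 3 * t - 2"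
proof (cases "\<exists>y\<in>excess v. (u, y) \<notin> E")
  case True
  then have "card (excess u) \<le> 3 * t - 2"
    using excess_clique[OF assms(1)] hole_excess[OF assms(1)] n_ge
    by (intro card_excess_clique) auto
  then show ?thesis ..
next
  case False
  then have "excess v \<subseteq> excess u" using assms(2) by blast
  then have "card (excess v) \<le> 3 * t - 2"
    using common_excess_clique[OF assms(1)] hole_excess[OF assms(1)] n_ge
    by (intro card_excess_clique) auto
  then show ?thesis ..
qed

text \<open>An edge pw with w at least 3t is outside U, so the blocked three-edge switch puts w into
  the closed neighbourhood of y. The other neighbours of p number at most 3t - 1.\<close>

lemma missed_hub_neighbours:
  assumes "(u, v) \<in> U - E" "x \<in> excess u" "y \<in> excess v" "p < n" "(x, p) \<notin> E" "p \<noteq> x" "p < 3 * t"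
  shows "d p \<le> d y + 3 * t"
proof -
  have sub: "E `` {p} \<inter> {3 * t..} \<subseteq> insert y (E `` {y})"
  proof
    fix w assume w: "w \<in> E `` {p} \<inter> {3 * t..}"
    then have "(p, w) \<in> E" "(p, w) \<notin> U" by (auto simp: hub_join_def)
    then show "w \<in> insert y (E `` {y})"
      using three_switch_blocked[OF assms(1), of x y p w] hole_excess[OF assms(1)] assms edge_sym
      by (auto simp: excess_iff)
  qed
  have "card (E `` {p} \<inter> {3 * t..}) \<le> card (insert y (E `` {y}))"
    using sub by (intro card_mono) auto
  also have "\<dots> \<le> d y + 1" using deg[of y] excess_lt[OF assms(3)] by (simp add: card_insert_if)
  finally have 1: "card (E `` {p} \<inter> {3 * t..}) \<le> d y + 1" .
  have "E `` {p} = (E `` {p} \<inter> {3 * t..}) \<union> (E `` {p} \<inter> {..<3 * t})" by auto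
  then have "d p \<le> card (E `` {p} \<inter> {3 * t..}) + card (E `` {p} \<inter> {..<3 * t})"
    using deg[of p] assms(4) by (metis card_Un_le lessThan_iff)
  moreover have "card (E `` {p} \<inter> {..<3 * t}) \<le> card ({..<3 * t} - {p})" by (intro card_mono) auto
  ultimately show ?thesis using 1 assms(7) by simp
qed

end

section \<open>Counting the hubs missed by vertices far from a hole\<close>

context hub_sequence
begin

text \<open>The closed neighbourhoods A, B of x, y in \<open>Out\<close> have size at most a, by
  \<open>deg_split\<close>. Up to one edge of U, every arc within \<open>Out\<close> starts in A or
  ends in B. With \<open>out_gt_miss\<close> this leaves few misses outside A and B, while each hub
  in L, having degree at most c, misses most of these vertices.\<close>

lemma blocked_count:
  assumes hole: "(u, v) \<in> U - E" and x: "x \<in> excess u" and y: "y \<in> excess v"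
    and L: "L \<subseteq> K" "\<And>p. p \<in> K \<Longrightarrow> (x, p) \<notin> E \<or> (y, p) \<notin> E \<Longrightarrow> p \<in> L" "\<And>p. p \<in> L \<Longrightarrow> d p \<le> c"
    and D1: "d x \<le> D1" "d y \<le> D1" "\<And>z. 3 * t \<le> z \<Longrightarrow> z < n \<Longrightarrow> d z \<le> D1"
    and D2: "\<And>z. z \<in> Out \<Longrightarrow> d z \<le> D2" "D1 \<le> D2" "2 * t - 1 \<le> D1"
  defines "a \<equiv> int D1 + 2 - 2 * int t + int (card L)"
  shows "2 * int (card L) * (int n - (2 * int t - 1) - 2 * a - int c)
    < 2 + 2 * (a * (int D1 - (2 * int t - 1)) + (int t + 1) * (int D2 - int D1))"
proof -
  note H = hole_excess[OF hole]
  define A where "A = insert x (E `` {x}) \<inter> Out"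
  define B where "B = insert y (E `` {y}) \<inter> Out"
  have fin: "finite A" "finite B" "finite L" and AB: "A \<subseteq> Out" "B \<subseteq> Out"
    using L(1) by (auto simp: A_def B_def intro: finite_subset)
  have card_nbhd: "int (card (insert z (E `` {z}) \<inter> Out)) \<le> a"
    if "d z \<le> D1" "z < n" "\<And>p. p \<in> K \<Longrightarrow> (z, p) \<notin> E \<Longrightarrow> p \<in> L" for z
  proof -
    have "miss z \<le> card L" unfolding miss_def using that(3) fin by (intro card_mono) auto
    moreover have "card (insert z (E `` {z}) \<inter> Out) \<le> out z + 1"
      unfolding out_def by (auto simp: Int_insert_left card_insert_if)
    ultimately show ?thesis using deg_split[OF that(2)] that(1) t2 unfolding a_def by simp
  qed
  have cardA: "int (card A) \<le> a" and cardB: "int (card B) \<le> a"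
    unfolding A_def B_def using card_nbhd[of x] card_nbhd[of y] D1 L(2) excess_lt x y by blast+
  have sub: "E \<inter> Out \<times> Out \<subseteq> (E \<inter> A \<times> Out) \<union> (E \<inter> Out \<times> B) \<union> {(2 * t - 1, 2 * t), (2 * t, 2 * t - 1)}"
  proof
    fix e assume "e \<in> E \<inter> Out \<times> Out"
    then obtain z w where e: "e = (z, w)" "(z, w) \<in> E" "z \<in> Out" "w \<in> Out" by auto
    show "e \<in> (E \<inter> A \<times> Out) \<union> (E \<inter> Out \<times> B) \<union> {(2 * t - 1, 2 * t), (2 * t, 2 * t - 1)}"
    proof (cases "(z, w) \<in> U")
      case True
      then show ?thesis using e by (auto simp: hub_join_def)
    next
      case False
      then have "(x, z) \<in> E \<or> x = z \<or> (y, w) \<in> E \<or> y = w"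
        using three_switch_blocked[OF hole H(5), of x y z w] x y e by (auto simp: excess_iff)
      then show ?thesis using e by (auto simp: A_def B_def)
    qed
  qed
  have arcs: "(\<Sum>z\<in>C. out z) = card (E \<inter> C \<times> Out)" if "finite C" for C
    unfolding out_def using card_Int_Times_sum[OF that fin_E] by simp
  have "(\<Sum>z\<in>Out. out z) \<le> card ((E \<inter> A \<times> Out) \<union> (E \<inter> Out \<times> B) \<union> {(2 * t - 1, 2 * t), (2 * t, 2 * t - 1)})"
    unfolding arcs[OF finite_atLeastLessThan] using sub fin_E by (intro card_mono) auto
  also have "\<dots> \<le> card (E \<inter> A \<times> Out) + card (E \<inter> Out \<times> B) + 2"
    by (intro order.trans[OF card_Un_le] add_mono) (auto simp: card_insert_if)
  also have "\<dots> = (\<Sum>z\<in>A. out z) + (\<Sum>z\<in>B. out z) + 2"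
    using card_Int_Times_swap[of E Out B] simple by (simp add: arcs fin simple_graph_onD)
  finally have 1: "(\<Sum>z\<in>Out. out z) \<le> (\<Sum>z\<in>A. out z) + (\<Sum>z\<in>B. out z) + 2" .
  \<comment> \<open>Only the t + 1 vertices of \<open>Out\<close> below 3t can have degree above D1;
    for these D2 is used.\<close>
  have sum_out: "int (\<Sum>z\<in>C. out z) \<le>
      a * (int D1 - (2 * int t - 1)) + (int t + 1) * (int D2 - int D1) + int (\<Sum>z\<in>C. miss z)"
    if "finite C" "C \<subseteq> Out" "int (card C) \<le> a" for C
  proof -
    have "int (out z) \<le> (int D1 - (2 * int t - 1)) + of_bool (z < 3 * t) * (int D2 - int D1) + int (miss z)"
      if "z \<in> C" for z
    proof -
      have "d z \<le> D1 + of_bool (z < 3 * t) * (D2 - D1)"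
        using D1(3)[of z] D2(1,2) that \<open>C \<subseteq> Out\<close> by (cases "z < 3 * t") force+
      moreover have "d z + miss z = 2 * t - 1 + out z" using deg_split[of z] that \<open>C \<subseteq> Out\<close> by auto
      ultimately show ?thesis using D2(2) t2 by (cases "z < 3 * t") auto
    qed
    then have "int (\<Sum>z\<in>C. out z) \<le> (\<Sum>z\<in>C. (int D1 - (2 * int t - 1)) + of_bool (z < 3 * t) * (int D2 - int D1) + int (miss z))"
      unfolding of_nat_sum by (rule sum_mono)
    also have "\<dots> = int (card C) * (int D1 - (2 * int t - 1)) + int (card {z \<in> C. z < 3 * t}) * (int D2 - int D1) + int (\<Sum>z\<in>C. miss z)"
      using that(1) by (simp add: sum.distrib sum_distrib_right[symmetric] of_bool_def sum.If_cases Int_def)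
    also have "int (card C) * (int D1 - (2 * int t - 1)) \<le> a * (int D1 - (2 * int t - 1))"
      using that(3) D2(3) t2 by (intro mult_right_mono) auto
    also have "int (card {z \<in> C. z < 3 * t}) * (int D2 - int D1) \<le> (int t + 1) * (int D2 - int D1)"
    proof (rule mult_right_mono)
      have "card {z \<in> C. z < 3 * t} \<le> card {2 * t - 1..<3 * t}"
        using that(2) by (intro card_mono) auto
      then show "int (card {z \<in> C. z < 3 * t}) \<le> int t + 1" using t2 by simp
    qed (use D2 in simp)
    finally show ?thesis by simp
  qed
  define W where "W = Out - (A \<union> B)"
  define q where "q = a * (int D1 - (2 * int t - 1)) + (int t + 1) * (int D2 - int D1)"
  have "(\<Sum>z\<in>Out. miss z) = (\<Sum>z\<in>W. miss z) + (\<Sum>z\<in>A \<union> B. miss z)"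
    unfolding W_def using AB by (intro sum.subset_diff) auto
  moreover have "(\<Sum>z\<in>A. miss z) \<le> (\<Sum>z\<in>A \<union> B. miss z)" "(\<Sum>z\<in>B. miss z) \<le> (\<Sum>z\<in>A \<union> B. miss z)"
    using fin by (auto intro: sum_mono2)
  \<comment> \<open>Twice the misses of \<open>A \<union> B\<close> absorb the misses of A and those
    of B, so only W remains.\<close>
  ultimately have 2: "2 * int (\<Sum>z\<in>W. miss z) < 2 + 2 * q"
    using out_gt_miss 1 sum_out[OF fin(1) AB(1) cardA, folded q_def] sum_out[OF fin(2) AB(2) cardB, folded q_def]
    by linarith
  have finW: "finite W" by (simp add: W_def)
  have cardW: "int (card W) \<ge> int n - (2 * int t - 1) - 2 * a"
  proof -
    have "card W = card Out - card (A \<union> B)" unfolding W_def using AB fin by (intro card_Diff_subset) auto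
    moreover have "card (A \<union> B) \<le> card A + card B" by (rule card_Un_le)
    moreover have "card (A \<union> B) \<le> card Out" using AB by (intro card_mono) auto
    ultimately show ?thesis using cardA cardB n_ge t2 by simp
  qed
  have "int (card L) * (int n - (2 * int t - 1) - 2 * a - int c) = (\<Sum>p\<in>L. int n - (2 * int t - 1) - 2 * a - int c)"
    by simp
  also have "\<dots> \<le> (\<Sum>p\<in>L. int (card (W - E `` {p})))"
  proof (rule sum_mono)
    fix p assume p: "p \<in> L"
    have "card W - card (E `` {p}) \<le> card (W - E `` {p})" by (rule diff_card_le_card_Diff) simp
    moreover have "card (E `` {p}) \<le> c" using deg[of p] L p n_ge by force
    ultimately show "int n - (2 * int t - 1) - 2 * a - int c \<le> int (card (W - E `` {p}))"
      using cardW by linarith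
  qed
  also have "\<dots> = int (\<Sum>z\<in>W. card (L - E `` {z}))"
    using sum_card_non_neighbours[OF finW fin(3), of E] simple by (simp add: simple_graph_onD)
  also have "\<dots> \<le> int (\<Sum>z\<in>W. miss z)"
    unfolding miss_def of_nat_le_iff using L(1) by (intro sum_mono card_mono) auto
  finally show ?thesis using 2 unfolding q_def[symmetric] by (simp only: mult.assoc)
qed

end

text \<open>Contradicts \<open>blocked_count\<close> for \<open>l = card L\<close>, with (D1, D2, c)
  equal to (6t - 4, 6t - 4, 9t - 4) or (5t - 3, 8t - 3, 8t - 3), as soon as L is nonempty.\<close>

lemma hub_count_arith:
  fixes l N T :: int
  assumes "1 \<le> l" "l \<le> 2 * T - 1" "2 \<le> T" "20 * T * T \<le> N + T"
  shows "2 + 2 * (((6 * T - 4) + 2 - 2 * T + l) * ((6 * T - 4) - (2 * T - 1)) + (T + 1) * ((6 * T - 4) - (6 * T - 4)))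
      \<le> 2 * l * (N - (2 * T - 1) - 2 * ((6 * T - 4) + 2 - 2 * T + l) - (9 * T - 4))" (is "?L1 \<le> ?R1")
    and "2 + 2 * (((5 * T - 3) + 2 - 2 * T + l) * ((5 * T - 3) - (2 * T - 1)) + (T + 1) * ((8 * T - 3) - (5 * T - 3)))
      \<le> 2 * l * (N - (2 * T - 1) - 2 * ((5 * T - 3) + 2 - 2 * T + l) - (8 * T - 3))" (is "?L2 \<le> ?R2")
proof -
  have TT: "0 \<le> (T - 2) * (16 * T - 4)" using assms by (intro mult_nonneg_nonneg) auto
  have "?L1 = 32 * (T * T) - 40 * T + 14 + 2 * l * (4 * T - 3)" by (simp add: algebra_simps)
  also have "\<dots> \<le> 2 * l * (20 * (T * T) - 24 * T + 11)"
  proof -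
    have "1 * (20 * (T * T) - 28 * T + 14) \<le> l * (20 * (T * T) - 28 * T + 14)"
      using assms TT by (intro mult_right_mono) (auto simp: algebra_simps)
    then show ?thesis using TT assms by (simp add: algebra_simps)
  qed
  also have "\<dots> \<le> ?R1" using assms by (intro mult_left_mono) auto
  finally show "?L1 \<le> ?R1" .
  have "?L2 = 24 * (T * T) - 12 * T + 6 + 2 * l * (3 * T - 2)" by (simp add: algebra_simps)
  also have "\<dots> \<le> 2 * l * (20 * (T * T) - 21 * T + 8)"
  proof -
    have "1 * (20 * (T * T) - 24 * T + 10) \<le> l * (20 * (T * T) - 24 * T + 10)"
      using assms TT by (intro mult_right_mono) (auto simp: algebra_simps)
    then show ?thesis using TT assms by (simp add: algebra_simps)
  qed
  also have "\<dots> \<le> ?R2" using assms by (intro mult_left_mono) auto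
  finally show "?L2 \<le> ?R2" .
qed

section \<open>Excluding the different kinds of holes\<close>

context hub_sequence
begin

text \<open>By \<open>missed_hub_neighbours\<close>, every hub missed by x or y has degree at most
  D1 + 3t. So the set L of all hubs of such degree fits \<open>blocked_count\<close>, and p makes it
  nonempty.\<close>

lemma low_hub_contradiction:
  assumes hole: "(u, v) \<in> U - E" and x: "x \<in> excess u" and y: "y \<in> excess v"
    and D: "D1 = 6 * t - 4 \<and> D2 = 6 * t - 4 \<or> D1 = 5 * t - 3 \<and> D2 = 8 * t - 3"
    and D1: "d x \<le> D1" "d y \<le> D1" "\<And>z. 3 * t \<le> z \<Longrightarrow> z < n \<Longrightarrow> d z \<le> D1"
    and D2: "\<And>z. z \<in> Out \<Longrightarrow> d z \<le> D2"
    and p: "p \<in> K" "d p \<le> D1 + 3 * t"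
  shows False
proof -
  note H = hole_excess[OF hole]
  define L where "L = {p \<in> K. d p \<le> D1 + 3 * t}"
  have L: "L \<subseteq> K" "p \<in> L" using p by (auto simp: L_def)
  then have fin: "finite L" using finite_subset by blast
  have "card L \<noteq> 0" using L fin by auto
  moreover have "card L \<le> card K" using L by (intro card_mono) auto
  ultimately have l: "1 \<le> int (card L)" "int (card L) \<le> 2 * int t - 1" using t2 by auto
  have missed: "p \<in> L" if "p \<in> K" "(x, p) \<notin> E \<or> (y, p) \<notin> E" for p
  proof -
    have *: "p < n" "p < 3 * t" "p \<noteq> x" "p \<noteq> y"
      using that n_ge excess_notin_K[OF x] excess_notin_K[OF y] H by auto
    have "d p \<le> d x + 3 * t \<or> d p \<le> d y + 3 * t"
      using missed_hub_neighbours[OF hole x y, of p] missed_hub_neighbours[OF H(6) y x, of p] * that by blast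
    then show ?thesis using that D1 unfolding L_def by auto
  qed
  have le: "d p \<le> D1 + 3 * t" if "p \<in> L" for p using that by (simp add: L_def)
  have "D1 \<le> D2" "2 * t - 1 \<le> D1" using D t2 by auto
  note c = blocked_count[OF hole x y L(1) missed le D1 D2 this]
  show False using D
  proof
    assume D: "D1 = 6 * t - 4 \<and> D2 = 6 * t - 4"
    then have "int D1 = 6 * int t - 4" "int D2 = 6 * int t - 4" "int (D1 + 3 * t) = 9 * int t - 4"
      using t2 by auto
    then show False
      using c hub_count_arith(1)[OF l _ n_large_int] t2 by (simp only: linorder_not_le[symmetric]) simp
  next
    assume D: "D1 = 5 * t - 3 \<and> D2 = 8 * t - 3"
    then have "int D1 = 5 * int t - 3" "int D2 = 8 * int t - 3" "int (D1 + 3 * t) = 8 * int t - 3"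
      using t2 by auto
    then show False
      using c hub_count_arith(2)[OF l _ n_large_int] t2 by (simp only: linorder_not_le[symmetric]) simp
  qed
qed

text \<open>The hub u itself serves as the low hub, and by sortedness its degree bounds all degrees
  in \<open>Out\<close>.\<close>

lemma no_hole_at_small_hub:
  assumes hole: "(u, v) \<in> U - E" and u: "u \<in> K" and du: "d u \<le> 6 * t - 4"
  shows False
proof -
  note H = hole_excess[OF hole]
  obtain x y where x: "x \<in> excess u" and y: "y \<in> excess v" using H by blast
  have D: "d z \<le> 6 * t - 4" if "2 * t - 1 \<le> z" "z < n" for z
    using sorted[of u z] that u du by auto
  show False
    by (rule low_hub_contradiction[OF hole x y, of "6 * t - 4" "6 * t - 4" u])
      (use D x y H excess_lt excess_notin_K u du in auto)
qed

lemma notin_U: "3 * t \<le> y \<Longrightarrow> (u, y) \<notin> U"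
  by (auto simp: hub_join_def)

text \<open>Excess neighbours of hubs are at least 3t, so the dichotomy applies. An excess of at
  most 3t - 2 and the U-degree 3t - 1 leave a degree of at most 6t - 4.\<close>

lemma no_hole_in_K:
  assumes hole: "(u, v) \<in> U - E" and uv: "u \<in> K" "v \<in> K"
  shows False
proof -
  note H = hole_excess[OF hole]
  have "y \<in> excess u" if "y \<in> excess v" "(u, y) \<in> E" for y
    using notin_U[OF excess_K[OF that(1)]] uv that(2) by (auto simp: excess_iff)
  then have "card (excess u) \<le> 3 * t - 2 \<or> card (excess v) \<le> 3 * t - 2"
    by (rule excess_clique_dichotomy[OF hole])
  then have "d u \<le> 6 * t - 4 \<or> d v \<le> 6 * t - 4"
    using deg_le_excess[OF hole] deg_le_excess[OF H(6)] uv finite_U_Image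
      card_U_Image[of u] card_U_Image[of v] H n_ge by auto
  then show False using no_hole_at_small_hub[OF hole] no_hole_at_small_hub[OF H(6)] uv by blast
qed

text \<open>The dichotomy bounds one of the two degrees, hence that of 2t, by 5t - 3. Some neighbour
  p of 2t is not adjacent to x; a blocked two-edge switch forces p to be a hub, and its degree is
  low.\<close>

lemma no_hole_in_spare_edge:
  assumes hole: "(2 * t - 1, 2 * t) \<in> U - E"
  shows False
proof -
  let ?a = "2 * t - 1" and ?b = "2 * t"
  note H = hole_excess[OF hole]
  have "y \<in> excess ?a" if "y \<in> excess ?b" "(?a, y) \<in> E" for y
  proof -
    have "(?b, y) \<notin> U" "y \<noteq> ?a" "y \<noteq> ?b" using that edge_sym H(6) by (auto simp: excess_iff)
    then have "(?a, y) \<notin> U" using t2 by (auto simp: hub_join_def)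
    with that show ?thesis by (auto simp: excess_iff)
  qed
  then have "card (excess ?a) \<le> 3 * t - 2 \<or> card (excess ?b) \<le> 3 * t - 2"
    by (rule excess_clique_dichotomy[OF hole])
  then have "d ?a \<le> 5 * t - 3 \<or> d ?b \<le> 5 * t - 3"
  proof -
    have "card (U `` {?a}) = 2 * t" "card (U `` {?b}) = 2 * t"
      using card_U_Image[of ?a] card_U_Image[of ?b] t2 by auto
    moreover have "?a < n" "?b < n" using n_ge t2 by auto
    ultimately show ?thesis
      using deg_le_excess[OF hole] deg_le_excess[OF H(6)] finite_U_Image t2 \<open>_ \<or> _\<close> by auto
  qed
  then have db: "d ?b \<le> 5 * t - 3" using sorted[of ?a ?b] n_ge t2 by auto
  have small: "d z \<le> d ?b" "d z \<le> 5 * t - 3" if "2 * t \<le> z" "z < n" for z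
    using sorted[of ?b z] that db by auto
  obtain x y where x: "x \<in> excess ?a" and y: "y \<in> excess ?b" using H by blast
  have "x \<noteq> ?a" "y \<noteq> ?a" using x y H(6) by (auto simp: excess_iff)
  then have xa: "2 * t \<le> x" "2 * t \<le> y" "x < n" "y < n"
    using excess_notin_K[OF x H(3)] excess_notin_K[OF y H(4)] excess_lt[OF x] excess_lt[OF y] by linarith+
  obtain p where p: "(?b, p) \<in> E" "(x, p) \<notin> E" "p \<noteq> x"
    using dominating_neighbour[of x ?b ?a] x xa small[of x] H edge_sym n_ge by (auto simp: excess_iff)
  have "(?b, p) \<in> U"
    using two_switch_blocked[OF hole H(5), of x p] x p by (auto simp: excess_iff)
  then have "p \<le> 2 * t" "p \<noteq> ?b" "p \<noteq> ?a" using p H(6) t2 by (auto simp: hub_join_def)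
  then have pK: "p \<in> K" by auto
  then have "p < n" "p < 3 * t" using n_ge by auto
  then have dp: "d p \<le> 5 * t - 3 + 3 * t"
    using missed_hub_neighbours[OF hole x y, of p] p small[of y] xa db by auto
  have "d z \<le> 8 * t - 3" if "z \<in> Out" for z using sorted[of p z] pK that dp by auto
  then show False
    using small(2) xa n_ge
    by (intro low_hub_contradiction[OF hole x y _ _ _ _ _ pK dp, of "8 * t - 3"]) auto
qed

end

text \<open>Meant for the neighbourhoods A of y and B of p: a vertex of no larger degree has no more
  private neighbours.\<close>

lemma card_Diff_insert_le:
  assumes "finite A" "finite B" "card A \<le> card B" "y \<in> B \<longleftrightarrow> p \<in> A" "p \<notin> B" "y \<notin> A"
  shows "card (A - insert p B) \<le> card (B - insert y A)"
proof -
  have "card (A - insert p B) = card A - card (A \<inter> insert p B)"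
    using assms by (simp add: card_Diff_subset_Int)
  moreover have "card (B - insert y A) = card B - card (B \<inter> insert y A)"
    using assms by (simp add: card_Diff_subset_Int)
  moreover have "card (A \<inter> insert p B) = card (B \<inter> insert y A)"
    using assms by (auto simp: Int_insert_right Int_commute)
  moreover have "card (B \<inter> insert y A) \<le> card B" using assms by (intro card_mono) auto
  ultimately show ?thesis using assms(3) by linarith
qed

text \<open>Here s counts hubs missed by all vertices of a large set and \<open>\<delta>\<close> is
  d u. The left side bounds the arcs avoiding the hubs, the right side twice the missed hubs, so
  \<open>out_gt_miss\<close> is contradicted.\<close>

lemma hub_spare_arith:
  fixes s t n \<delta> :: int
  assumes "2 \<le> t" "3 \<le> s" "s \<le> 2 * t - 1" "20 * t * t \<le> n + t" "\<delta> + 1 \<le> s * t + (3 * t - 1)"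
  shows "2 * (\<delta> * (4 * t - 1)) + (3 * t - 1) * (3 * t - 1) \<le> 2 * (s * (n - 3 * t - \<delta>))"
proof -
  have st: "s * t \<le> (2 * t - 1) * t" "3 * t \<le> s * t" using assms by (auto intro: mult_right_mono)
  have tt: "2 * t \<le> t * t" using assms by (intro mult_right_mono) auto
  have "\<delta> \<le> 2 * (s * t)" using assms(5) st by linarith
  then have "2 * (\<delta> * (4 * t - 1)) \<le> 2 * (2 * (s * t) * (4 * t - 1))"
    using assms by (intro mult_left_mono mult_right_mono) auto
  also have "\<dots> = s * (16 * (t * t) - 4 * t)" by (simp add: algebra_simps)
  finally have 1: "2 * (\<delta> * (4 * t - 1)) \<le> s * (16 * (t * t) - 4 * t)" .
  have "(3 * t - 1) * (3 * t - 1) \<le> 3 * (3 * (t * t))" using assms by (simp add: algebra_simps)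
  also have "\<dots> \<le> s * (3 * (t * t))" using assms by (intro mult_right_mono) auto
  finally have 2: "(3 * t - 1) * (3 * t - 1) \<le> s * (3 * (t * t))" .
  have "18 * (t * t) - 6 * t \<le> n - 3 * t - \<delta>"
    using assms st by (simp add: algebra_simps)
  then have "s * (18 * (t * t) - 6 * t) \<le> s * (n - 3 * t - \<delta>)"
    using assms by (intro mult_left_mono) auto
  moreover have "s * (16 * (t * t) - 4 * t) + s * (3 * (t * t)) \<le> 2 * (s * (18 * (t * t) - 6 * t))"
  proof -
    have "s * ((16 * (t * t) - 4 * t) + (3 * (t * t))) \<le> s * (2 * (18 * (t * t) - 6 * t))"
      using assms tt by (intro mult_left_mono) auto
    then show ?thesis by (simp add: algebra_simps)
  qed
  ultimately show ?thesis using 1 2 by linarith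
qed

context hub_sequence
begin

text \<open>Each \<open>x\<close> in the excess of \<open>u\<close> misses a neighbour \<open>p\<close> of \<open>v\<close> in \<open>U\<close>. The blocked switches along
  edges at \<open>p\<close> force \<open>p\<close> and \<open>y\<close> to have almost the same neighbours, so few such \<open>x\<close> share the same
  \<open>p\<close>. With \<open>s\<close> of these hubs (counting \<open>u\<close>), all vertices outside a set of size \<open>O(s t)\<close> miss them,
  which leaves too many non-edges at the hubs.\<close>

lemma no_hole_with_internal_excess:
  assumes hole: "(u, v) \<in> U - E" and u: "u \<in> K" and v: "2 * t - 1 \<le> v"
    and big: "3 * t - 1 \<le> card (excess u)" and inner: "excess v \<subseteq> {..<3 * t}"
  shows False
proof -
  note H = hole_excess[OF hole]
  have n: "u < n" "v < n" using H n_ge by auto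
  \<comment> \<open>Excess and U-neighbours of v are disjoint sets among the 3t - 1 other vertices
    below 3t, and the U-neighbour u is not adjacent to v in E.\<close>
  have dv: "d v \<le> 3 * t - 2"
  proof -
    have "card (excess v \<union> U `` {v}) \<le> card ({..<3 * t} - {v})"
      using inner U_Image[OF H(4)] v H(4) by (intro card_mono) (auto simp: excess_iff split: if_splits)
    moreover have "card (excess v \<union> U `` {v}) = card (excess v) + card (U `` {v})"
      using finite_U_Image by (intro card_Un_disjoint) (auto simp: excess_iff)
    ultimately show ?thesis using deg_le_excess[OF H(6)] n finite_U_Image H(4) by auto
  qed
  have small: "d z \<le> 3 * t - 2" if "3 * t \<le> z" "z < n" for z
    using sorted[of v z] that H(4) dv by auto
  define X where "X = excess u"
  have X: "3 * t \<le> x" "x < n" "(u, x) \<in> E" "(x, u) \<in> E" if "x \<in> X" for x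
    using that excess_K[of x u] u excess_lt edge_sym by (auto simp: X_def excess_iff)
  have finX: "finite X" by (simp add: X_def)
  obtain y where y: "y \<in> excess v" using H by blast
  have yv: "(v, y) \<in> E" "(y, v) \<in> E" "(v, y) \<notin> U" "2 * t - 1 \<le> y" "y < 3 * t" "y \<noteq> v"
    using y inner excess_notin_K[OF y H(4)] edge_sym by (auto simp: excess_iff)
  have y_n: "y < n" using yv n_ge by simp
  have Xy: "(y, x) \<in> E" if "x \<in> X" for x
    using two_switch_blocked[OF hole H(5), of x y] that y X[OF that] yv edge_sym
    by (auto simp: X_def excess_iff)
  \<comment> \<open>P and Q collect the neighbours of v along U that some x in X misses: hubs in P,
    and in Q possibly the other end of the spare edge.\<close>
  define P where "P = {p \<in> K. (v, p) \<in> E \<and> (\<exists>x\<in>X. (x, p) \<notin> E)}"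
  define Q where "Q = {p \<in> {2 * t - 1, 2 * t} - {v}. (v, p) \<in> E \<inter> U \<and> (\<exists>x\<in>X. (x, p) \<notin> E)}"
  have fin: "finite P" "finite Q" by (auto simp: P_def Q_def)
  have twin: "E `` {p} \<inter> {3 * t..} \<subseteq> E `` {y}" "card (E `` {y} - insert p (E `` {p})) \<le> t"
    if p: "p \<in> P \<union> Q" for p
  proof -
    obtain x where x: "x \<in> X" "(x, p) \<notin> E" using p by (auto simp: P_def Q_def)
    have pt: "p \<le> y" "p < 3 * t" "(v, p) \<in> E" "p \<noteq> y" "x \<noteq> p"
    proof -
      show "(v, p) \<in> E" "p < 3 * t" using p t2 by (auto simp: P_def Q_def)
      then show "x \<noteq> p" using X[OF x(1)] by auto
      show "p \<noteq> y" using p yv by (auto simp: P_def Q_def)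
      show "p \<le> y"
      proof (cases "p \<in> K")
        case True
        then show ?thesis using yv by simp
      next
        case False
        then have "p \<in> Q" using p by (auto simp: P_def)
        then have "v \<le> 2 * t" using v H(4) by (auto simp: Q_def hub_join_def)
        then have "2 * t < y" using yv v t2 by (auto simp: hub_join_def)
        with \<open>p \<in> Q\<close> show ?thesis by (auto simp: Q_def)
      qed
    qed
    \<comment> \<open>If q is at least 3t, pq is outside U; if q is a hub, the gained edge yq is in
      U. Either way the three-edge switch must be blocked, so p has at most t private neighbours
      against y.\<close>
    have out_nbr: "2 * t - 1 \<le> q \<and> q < 3 * t" if q: "(p, q) \<in> E" "(y, q) \<notin> E" "q \<noteq> y" for q
    proof (rule ccontr)
      assume "\<not> ?thesis"
      then have "(p, q) \<notin> U \<or> (y, q) \<in> U" using yv pt q(3) by (auto simp: hub_join_def)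
      then show False
        using three_switch_blocked[OF hole H(5), of x y p q] x y q pt by (auto simp: X_def excess_iff)
    qed
    then show "E `` {p} \<inter> {3 * t..} \<subseteq> E `` {y}" using yv by force
    have "card (E `` {y} - insert p (E `` {p})) \<le> card (E `` {p} - insert y (E `` {y}))"
      using sorted[OF pt(1) y_n] deg[of p] deg[of y] y_n pt edge_sym
      by (intro card_Diff_insert_le) auto
    also have "\<dots> \<le> card ({2 * t - 1..<3 * t} - {y})"
      using out_nbr by (intro card_mono) auto
    also have "\<dots> = t" using yv t2 by simp
    finally show "card (E `` {y} - insert p (E `` {p})) \<le> t" .
  qed
  \<comment> \<open>As \<open>d x \<le> d v\<close>, x misses a neighbour p of v, which a blocked
    two-edge switch places in P or Q. Being adjacent to y, x is one of the at most t private
    neighbours of y against p.\<close>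
  have cover: "X \<subseteq> (\<Union>p\<in>P \<union> Q. E `` {y} - insert p (E `` {p}))"
  proof
    fix x assume x: "x \<in> X"
    have "d x \<le> d v" using sorted[of v x] X[OF x] H(4) by auto
    then obtain p where p: "(v, p) \<in> E" "(x, p) \<notin> E" "p \<noteq> x"
      using dominating_neighbour[of x v u] X[OF x] n H(5,6) by auto
    have vpU: "(v, p) \<in> U"
      using two_switch_blocked[OF hole H(5), of x p] x p by (auto simp: X_def excess_iff)
    have "p \<noteq> v" using p by auto
    then have "p \<in> P \<union> Q" using vpU p x v by (auto simp: P_def Q_def hub_join_def)
    then show "x \<in> (\<Union>p\<in>P \<union> Q. E `` {y} - insert p (E `` {p}))"
      using p Xy[OF x] edge_sym by (auto intro!: bexI[of _ p])
  qed
  \<comment> \<open>The 1 serves twice: here for the possible element of Q, below for u among the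
    missed hubs.\<close>
  define s where "s = card P + 1"
  have "card Q \<le> 1"
  proof (cases "v \<in> {2 * t - 1, 2 * t}")
    case True
    have "card Q \<le> card ({2 * t - 1, 2 * t} - {v})" unfolding Q_def by (intro card_mono) auto
    also have "\<dots> \<le> 1" using True t2 by (auto simp: card_insert_if)
    finally show ?thesis .
  next
    case False
    then have "Q = {}" using v by (auto simp: Q_def hub_join_def)
    then show ?thesis by simp
  qed
  then have cPQ: "card (P \<union> Q) \<le> s" using card_Un_le[of P Q] by (simp add: s_def)
  have "card X \<le> card (\<Union>p\<in>P \<union> Q. E `` {y} - insert p (E `` {p}))"
    using cover fin by (intro card_mono) auto
  also have "\<dots> \<le> (\<Sum>p\<in>P \<union> Q. card (E `` {y} - insert p (E `` {p})))"
    using fin by (intro card_UN_le) auto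
  also have "\<dots> \<le> (\<Sum>p\<in>P \<union> Q. t)" using twin(2) by (intro sum_mono) auto
  also have "\<dots> \<le> s * t" using cPQ by simp
  finally have cX: "card X \<le> s * t" .
  have s3: "3 \<le> s"
  proof (rule ccontr)
    assume "\<not> 3 \<le> s"
    then have "s * t \<le> 2 * t" by (intro mult_right_mono) auto
    then show False using cX big t2 unfolding X_def by linarith
  qed
  have uP: "u \<notin> P" using H by (auto simp: P_def)
  have sK: "card (insert u P) \<le> card K" using u by (intro card_mono) (auto simp: P_def)
  then have s_le: "s \<le> 2 * t - 1" using uP fin by (simp add: s_def)
  have du: "d u + 1 \<le> s * t + (3 * t - 1)"
    using deg_le_excess[OF hole] n finite_U_Image card_U_Image[OF H(3)] u cX by (auto simp: X_def)
  define J where "J = E `` {y} \<inter> {3 * t..}"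
  define R where "R = {2 * t - 1..<3 * t}"
  \<comment> \<open>A vertex of W is not adjacent to u, or it would lie in X and be adjacent to y;
    nor to any p in P, by \<open>twin\<close>. So it misses s hubs.\<close>
  define W where "W = {3 * t..<n} - J"
  have finJ: "finite J" "finite R" "finite W" by (auto simp: J_def R_def W_def)
  have Jn: "J \<subseteq> {3 * t..<n}" using edge_in by (auto simp: J_def)
  have cJ: "card J \<le> d u"
  proof -
    have "card J \<le> card (E `` {y})" unfolding J_def by (intro card_mono) auto
    then show ?thesis using deg[of y] y_n sorted[of u y] u yv by auto
  qed
  have Out: "Out = R \<union> J \<union> W" 
  proof -
    have "Out = R \<union> {3 * t..<n}" using n_ge t2 by (auto simp: R_def)
    then show ?thesis using Jn by (auto simp: W_def)
  qed
  have "s * card W \<le> (\<Sum>w\<in>W. miss w)"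
  proof -
    have "s \<le> miss w" if w: "w \<in> W" for w
    proof -
      have "(u, w) \<notin> E"
      proof
        assume "(u, w) \<in> E"
        then have "w \<in> X" using w notin_U[of w u] by (auto simp: W_def X_def excess_iff)
        then show False using Xy w by (auto simp: W_def J_def)
      qed
      moreover have "(p, w) \<notin> E" if "p \<in> P" for p
        using twin(1)[of p] that w by (auto simp: W_def J_def)
      ultimately have "insert u P \<subseteq> K - E `` {w}" using u edge_sym by (auto simp: P_def)
      then have "card (insert u P) \<le> miss w" unfolding miss_def by (intro card_mono) auto
      then show ?thesis using uP fin by (simp add: s_def)
    qed
    then have "(\<Sum>w\<in>W. s) \<le> (\<Sum>w\<in>W. miss w)" by (rule sum_mono)
    then show ?thesis by (simp add: mult.commute)
  qed
  also have "\<dots> \<le> (\<Sum>w\<in>Out. miss w)" unfolding Out using finJ by (intro sum_mono2) auto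
  finally have low: "s * card W \<le> (\<Sum>w\<in>Out. miss w)" .
  obtain x where x: "x \<in> X" using big t2 by (fastforce simp: X_def)
  define S where "S = insert x (E `` {x})"
  have cS: "card S \<le> 3 * t - 1" "finite S"
    using small[of x] X[OF x] deg[of x] t2 by (auto simp: S_def card_insert_if)
  \<comment> \<open>No vertex of W is adjacent to y, so a switch along an edge within W can be
    blocked only at x.\<close>
  have WW: "E \<inter> W \<times> W \<subseteq> S \<times> S"
  proof -
    have "w \<in> S" if "(w, w') \<in> E" "w \<in> W" "w' \<in> W" for w w'
    proof -
      have "(w, w') \<notin> U" "(y, w') \<notin> E" "y \<noteq> w'"
        using that yv notin_U[of w' w] by (auto simp: W_def J_def)
      then show ?thesis
        using three_switch_blocked[OF hole H(5), of x y w w'] that x y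
        by (auto simp: X_def excess_iff S_def)
    qed
    then show ?thesis using edge_sym by blast
  qed
  have arcs: "(\<Sum>z\<in>C. out z) = card (E \<inter> C \<times> Out)" if "finite C" for C
    unfolding out_def using card_Int_Times_sum[OF that fin_E] by simp
  have "(\<Sum>z\<in>Out. out z) \<le> card ((E \<inter> (R \<union> J) \<times> Out) \<union> (E \<inter> Out \<times> (R \<union> J)) \<union> S \<times> S)"
    unfolding arcs[OF finite_atLeastLessThan]
    using fin_E cS(2) WW Out by (intro card_mono) blast+
  also have "\<dots> \<le> card (E \<inter> (R \<union> J) \<times> Out) + card (E \<inter> Out \<times> (R \<union> J)) + card (S \<times> S)"
    by (intro order.trans[OF card_Un_le] add_mono card_Un_le) auto
  also have "\<dots> = 2 * (\<Sum>z\<in>R \<union> J. out z) + card S * card S"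
    using card_Int_Times_swap[of E Out "R \<union> J"] simple finJ
    by (simp add: arcs simple_graph_onD card_cartesian_product)
  also have "(\<Sum>z\<in>R \<union> J. out z) \<le> (\<Sum>z\<in>R. out z) + (\<Sum>z\<in>J. out z)"
    using sum.union_inter[OF finJ(2,1), of out] by linarith
  also have "(\<Sum>z\<in>R. out z) \<le> (\<Sum>z\<in>R. d u)"
  proof (rule sum_mono)
    fix z assume "z \<in> R"
    then have "u \<le> z" "z < n" using u n_ge by (auto simp: R_def)
    moreover have "out z \<le> card (E `` {z})" unfolding out_def by (intro card_mono) auto
    ultimately show "out z \<le> d u" using deg[of z] sorted[of u z] by auto
  qed
  also have "(\<Sum>z\<in>R. d u) = (t + 1) * d u" using t2 by (simp add: R_def)
  also have "(\<Sum>z\<in>J. out z) \<le> (\<Sum>z\<in>J. 3 * t - 2)"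
  proof (rule sum_mono)
    fix z assume "z \<in> J"
    then have z: "3 * t \<le> z" "z < n" using Jn by auto
    have "out z \<le> card (E `` {z})" unfolding out_def by (intro card_mono) auto
    then show "out z \<le> 3 * t - 2" using deg[of z] small[OF z] z by auto
  qed
  also have "(\<Sum>z\<in>J. 3 * t - 2) \<le> d u * (3 * t - 2)" using cJ by simp
  also have "card S * card S \<le> (3 * t - 1) * (3 * t - 1)" using cS by (intro mult_mono) auto
  finally have "(\<Sum>z\<in>Out. out z) \<le> 2 * ((t + 1) * d u + d u * (3 * t - 2)) + (3 * t - 1) * (3 * t - 1)"
    by simp
  also have "(t + 1) * d u + d u * (3 * t - 2) = d u * (4 * t - 1)"
    using t2 by (simp add: algebra_simps flip: add_mult_distrib2)
  finally have up: "(\<Sum>z\<in>Out. out z) \<le> 2 * (d u * (4 * t - 1)) + (3 * t - 1) * (3 * t - 1)" .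
  have "card W = card {3 * t..<n} - card J" unfolding W_def using Jn finJ by (intro card_Diff_subset) auto
  then have cW: "int n - 3 * int t - int (d u) \<le> int (card W)" using cJ by simp
  have "int s * (int n - 3 * int t - int (d u)) \<le> int s * int (card W)"
    using cW by (intro mult_left_mono) auto
  moreover have "2 * (int s * int (card W)) < 2 * (int (d u) * (4 * int t - 1)) + (3 * int t - 1) * (3 * int t - 1)"
  proof -
    have "2 * (s * card W) < 2 * (d u * (4 * t - 1)) + (3 * t - 1) * (3 * t - 1)"
      using up low out_gt_miss by linarith
    then have "int (2 * (s * card W)) < int (2 * (d u * (4 * t - 1)) + (3 * t - 1) * (3 * t - 1))"
      by (simp only: of_nat_less_iff)
    then show ?thesis using t2 by (simp add: of_nat_diff)
  qed
  moreover have "int (d u) + 1 \<le> int s * int t + (3 * int t - 1)"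
  proof -
    have "int (d u + 1) \<le> int (s * t + (3 * t - 1))" using du by (simp only: of_nat_le_iff)
    then show ?thesis using t2 by (simp add: of_nat_diff)
  qed
  ultimately show False
    using hub_spare_arith[of "int t" "int s" "int n" "int (d u)"] t2 s3 s_le n_large_int by linarith
qed

text \<open>The excess of u is too large for a clique, so it has a vertex x not adjacent to v. Then
  the excess of v is a clique and \<open>d v \<le> 5 * t - 3\<close>. If it has a vertex y at least
  3t, all excess neighbours of u lie in the closed neighbourhood of y and u is a low hub; otherwise
  the internal case applies.\<close>

lemma no_hole_between:
  assumes hole: "(u, v) \<in> U - E" and u: "u \<in> K" and v: "2 * t - 1 \<le> v"
  shows False
proof -
  note H = hole_excess[OF hole]
  have n: "u < n" "v < n" using H n_ge by auto
  have "6 * t - 4 < d u" using no_hole_at_small_hub[OF hole u] by (meson not_le)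
  then have big: "3 * t - 1 \<le> card (excess u)"
    using deg_le_excess[OF hole] n finite_U_Image card_U_Image[OF H(3)] u by auto
  have yu: "(u, y) \<in> E" if y: "y \<in> excess v" for y
  proof (rule ccontr)
    assume "(u, y) \<notin> E"
    then have "card (excess u) \<le> 3 * t - 2"
      using excess_clique[OF hole H(5) y] n by (intro card_excess_clique) auto
    then show False using big t2 by simp
  qed
  have "\<exists>x\<in>excess u. (v, x) \<notin> E"
  proof (rule ccontr)
    assume "\<not> ?thesis"
    then have "excess u \<subseteq> excess v"
      using excess_K u notin_U by (auto simp: excess_iff)
    then have "card (excess u) \<le> 3 * t - 2"
      using common_excess_clique[OF hole H(5)] n by (intro card_excess_clique) auto
    then show False using big t2 by simp
  qed
  then obtain x where x: "x \<in> excess u" "(v, x) \<notin> E" by blast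
  have "card (excess v) \<le> 3 * t - 2"
    using excess_clique[OF H(6) _ x] H(5) n by (intro card_excess_clique) auto
  then have dv: "d v \<le> 5 * t - 3"
    using deg_le_excess[OF H(6)] n finite_U_Image card_U_Image[OF H(4)] v t2 by (auto split: if_splits)
  have small: "d z \<le> 5 * t - 3" if "3 * t \<le> z" "z < n" for z
    using sorted[of v z] that H(4) dv by auto
  have "excess v \<subseteq> {..<3 * t}"
  proof (rule subsetI, rule ccontr)
    fix y assume y: "y \<in> excess v" "y \<notin> {..<3 * t}"
    then have yn: "3 * t \<le> y" "y < n" using excess_lt by auto
    have "excess u \<subseteq> insert y (E `` {y})"
    proof
      fix x assume "x \<in> excess u"
      then have "(x, y) \<in> E \<or> x = y"
        using two_switch_blocked[OF hole H(5), of x y] y by (auto simp: excess_iff)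
      then show "x \<in> insert y (E `` {y})" using edge_sym by auto
    qed
    then have "card (excess u) \<le> card (insert y (E `` {y}))" by (intro card_mono) auto
    also have "\<dots> \<le> d y + 1" using deg[of y] yn by (simp add: card_insert_if)
    finally have "card (excess u) \<le> 5 * t - 2" using small[OF yn] t2 by simp
    then have du: "d u \<le> 5 * t - 3 + 3 * t"
      using deg_le_excess[OF hole] n finite_U_Image card_U_Image[OF H(3)] u by auto
    have "d z \<le> 8 * t - 3" if "z \<in> Out" for z using sorted[of u z] u that du by auto
    then show False
      using small yn excess_K[OF x(1)] u excess_lt[OF x(1)]
      by (intro low_hub_contradiction[OF hole x(1) y(1) _ _ _ _ _ u du, of "8 * t - 3"]) auto
  qed
  then show False using no_hole_with_internal_excess[OF hole u v big] by blast
qed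

theorem hub_join_subset: "U \<subseteq> E"
proof
  fix e assume "e \<in> U"
  then obtain u v where e: "e = (u, v)" "(u, v) \<in> U" by (cases e) auto
  show "e \<in> E"
  proof (rule ccontr)
    assume "e \<notin> E"
    with e have hole: "(u, v) \<in> U - E" by auto
    note H = hole_excess[OF hole]
    consider "u \<in> K" "v \<in> K" | "u \<in> K" "2 * t - 1 \<le> v" | "v \<in> K" "2 * t - 1 \<le> u"
      | "u = 2 * t - 1" "v = 2 * t" | "v = 2 * t - 1" "u = 2 * t"
    proof -
      from e(2) have "u < 2 * t - 1 \<or> v < 2 * t - 1 \<or> u \<le> 2 * t \<and> v \<le> 2 * t"
        by (auto simp: hub_join_def)
      then have "u < 2 * t - 1 \<and> v < 2 * t - 1 \<or> u < 2 * t - 1 \<and> 2 * t - 1 \<le> v \<or>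
          v < 2 * t - 1 \<and> 2 * t - 1 \<le> u \<or> u = 2 * t - 1 \<and> v = 2 * t \<or> v = 2 * t - 1 \<and> u = 2 * t"
        using H(5) by linarith
      then show thesis using that by auto
    qed
    then show False
      using hole H(6) no_hole_in_K no_hole_between no_hole_in_spare_edge by cases auto
  qed
qed

end

section \<open>At most \<open>2t - 2\<close> large degrees\<close>

text \<open>The universal graph for \<open>j \<ge> 2\<close>: the join of a clique on the first \<open>2t - j\<close> vertices with the disjoint union of a cocktail
  party graph on the next \<open>2j\<close> vertices and \<open>t - j\<close> isolated vertices.\<close>

definition cocktail_join :: "nat \<Rightarrow> nat \<Rightarrow> (nat \<times> nat) set" where
  "cocktail_join t j = {(i, k). i \<noteq> k \<and> i < 3 * t \<and> k < 3 * t \<and>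
    (i < 2 * t - j \<or> k < 2 * t - j \<or>
      i < 2 * t + j \<and> k < 2 * t + j \<and> (i - (2 * t - j)) div 2 \<noteq> (k - (2 * t - j)) div 2)}"

locale few_hubs_sequence = dense_sequence n t d + maximal_realization "{..<n}" d "cocktail_join t j" E
  for n t j :: nat and d :: "nat \<Rightarrow> nat" and E :: "(nat \<times> nat) set" +
  assumes j: "2 \<le> j" "j \<le> t"
    and hubs: "\<And>i. i < 2 * t - j \<Longrightarrow> 3 * t - 1 \<le> d i"
    and non_hubs: "\<And>i. 2 * t - j \<le> i \<Longrightarrow> i < n \<Longrightarrow> d i < 3 * t - 1"
begin

abbreviation "U \<equiv> cocktail_join t j"
abbreviation "H \<equiv> {..<2 * t - j}"
abbreviation "Out \<equiv> {2 * t - j..<n}"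

lemma H_sub: "H \<subseteq> {..<n}" using n_ge by auto

lemma V_minus_H: "{..<n} - H = Out" by auto

lemma deg_lt: "v < n \<Longrightarrow> d v \<le> n - 1"
proof -
  assume v: "v < n"
  have "card (E `` {v}) \<le> card ({..<n} - {v})" using edge_in by (intro card_mono) auto
  then show ?thesis using deg[of v] v by simp
qed

text \<open>The bound is the U-degree of a cocktail party vertex: 2t - j hubs and 2j - 2 others. If
  it failed, degrees n - 1 at the hubs and 2t + j - 3 from 3t - 1 on would give n only the
  coefficient 4t - 3.\<close>

lemma deg_low: "2 * t + j - 2 \<le> d (3 * t - 1)"
proof (rule ccontr)
  assume neg: "\<not> ?thesis"
  let ?h = "2 * t - j"
  have *: "d i \<le> 2 * t + j - 3" if "3 * t - 1 \<le> i" "i < n" for i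
    using sorted[of "3 * t - 1" i] that neg j t2 by auto
  have "{..<n} = H \<union> ({?h..<3 * t - 1} \<union> {3 * t - 1..<n})" using n_ge t2 j by auto
  also have "(\<Sum>i\<in>\<dots>. d i) = (\<Sum>i\<in>H. d i) + ((\<Sum>i\<in>{?h..<3 * t - 1}. d i) + (\<Sum>i\<in>{3 * t - 1..<n}. d i))"
    using t2 j by (subst sum.union_disjoint, auto, subst sum.union_disjoint, auto)
  also have "\<dots> \<le> (\<Sum>i\<in>H. n - 1) + ((\<Sum>i\<in>{?h..<3 * t - 1}. 3 * t - 2) + (\<Sum>i\<in>{3 * t - 1..<n}. 2 * t + j - 3))"
  proof (intro add_mono sum_mono)
    fix i assume "i \<in> H"
    then show "d i \<le> n - 1" using deg_lt n_ge by auto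
  next
    fix i assume "i \<in> {?h..<3 * t - 1}"
    then have "d i < 3 * t - 1" using n_ge by (intro non_hubs) auto
    then show "d i \<le> 3 * t - 2" by simp
  qed (use * in auto)
  also have "\<dots> = ?h * (n - 1) + ((3 * t - 1 - ?h) * (3 * t - 2) + (n - (3 * t - 1)) * (2 * t + j - 3))" by simp
  finally have "int (\<Sum>i<n. d i) \<le> int (?h * (n - 1) + ((3 * t - 1 - ?h) * (3 * t - 2) + (n - (3 * t - 1)) * (2 * t + j - 3)))"
    by (simp only: of_nat_le_iff)
  also have "\<dots> = (2 * int t - int j) * (int n - 1) + ((int t + int j - 1) * (3 * int t - 2) + (1 + int n - 3 * int t) * (2 * int t + int j - 3))"
    using t2 j n_ge by (simp add: of_nat_diff)
  also have "\<dots> = 4 * (int t * int n) - 3 * int n - 3 * (int t * int t) + 4 * int t - 1"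
    by (simp add: algebra_simps)
  finally have "int (\<Sum>i<n. d i) \<le> \<dots>" .
  moreover have "2 * int t \<le> int t * int t" using t2 by (intro mult_right_mono) auto
  ultimately show False using sum_large_int n_large_int t2 unfolding mult.assoc by linarith
qed

lemma U_lt: "(u, v) \<in> U \<Longrightarrow> u < 3 * t \<and> v < 3 * t \<and> u \<noteq> v"
  by (auto simp: cocktail_join_def)

lemma finite_U_Image: "finite (U `` {v})"
  by (rule finite_subset[of _ "{..<3 * t}"]) (auto dest: U_lt)

lemma deg_ge_U:
  assumes "v < 3 * t"
  shows "card (U `` {v}) \<le> d v"
proof (cases "v < 2 * t - j")
  case True
  have "card (U `` {v}) \<le> card ({..<3 * t} - {v})" by (intro card_mono) (auto dest: U_lt)
  then show ?thesis using hubs[OF True] assms by simp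
next
  case v: False
  have "v \<le> 3 * t - 1" "3 * t - 1 < n" using assms n_ge by auto
  then have low: "2 * t + j - 2 \<le> d v" using deg_low sorted[of v "3 * t - 1"] by auto
  show ?thesis
  proof (cases "v < 2 * t + j")
    case False
    then have "card (U `` {v}) \<le> card H" using v by (intro card_mono) (auto simp: cocktail_join_def)
    then show ?thesis using low j by simp
  next
    case True
    define i where "i = v - (2 * t - j)"
    \<comment> \<open>m is the partner of v in the cocktail party graph.\<close>
    define m where "m = (2 * t - j) + (if even i then i + 1 else i - 1)"
    have vi: "v = 2 * t - j + i" using v by (simp add: i_def)
    have m: "m \<noteq> v" "m < 2 * t + j"
    proof -
      show "m \<noteq> v" unfolding m_def vi by (auto elim: oddE)
      show "m < 2 * t + j"
      proof (cases "even i")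
        case True
        then have "i + 1 < 2 * j" using \<open>v < 2 * t + j\<close> vi j by presburger
        then show ?thesis using True j by (simp add: m_def)
      next
        case False
        then show ?thesis using \<open>v < 2 * t + j\<close> vi by (auto simp: m_def)
      qed
    qed
    have "(if even i then i + 1 else i - 1) div 2 = i div 2" by (auto elim!: evenE oddE)
    then have "(v, m) \<notin> U" using v True by (auto simp: cocktail_join_def m_def i_def)
    then have "U `` {v} \<subseteq> {..<2 * t + j} - {v, m}"
      using v by (auto simp: cocktail_join_def)
    then have "card (U `` {v}) \<le> card ({..<2 * t + j} - {v, m})" by (intro card_mono) auto
    also have "\<dots> = 2 * t + j - 2" using m True by (subst card_Diff_subset) auto
    finally show ?thesis using low by simp
  qed
qed

text \<open>With h = 2t - j hubs, the arcs touching a hub number at most f(h) = h(2n - 1 - h), which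
  is at most f(2t - 2). The threshold exceeds f(2t - 2) by 2n - 4t + 2.\<close>

lemma many_outer_arcs: "2 * int n - 4 * int t + 2 < int (\<Sum>z\<in>Out. card (E `` {z} \<inter> Out))"
proof -
  note s = realizes_degree_sum_split[OF realizes H_sub, unfolded V_minus_H]
  let ?h = "2 * t - j"
  have "(\<Sum>z\<in>Out. card (E `` {z} \<inter> H)) \<le> (\<Sum>z\<in>Out. ?h)"
    by (rule sum_mono) (metis card_lessThan card_mono finite_lessThan inf_le2)
  then have "int (\<Sum>z\<in>Out. card (E `` {z} \<inter> H)) \<le> int ((n - ?h) * ?h)"
    unfolding of_nat_le_iff by simp
  then have 1: "int (\<Sum>z\<in>Out. card (E `` {z} \<inter> H)) \<le> (int n - int ?h) * int ?h"
    using n_ge by (simp add: of_nat_diff del: of_nat_sum)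
  have 2: "int (card (E \<inter> H \<times> H)) + int ?h \<le> int ?h * int ?h"
    using s(3)[folded of_nat_le_iff[where ?'a = int]] by simp
  have 3: "int (\<Sum>i<n. d i) = int (card (E \<inter> H \<times> H)) + 2 * int (\<Sum>z\<in>Out. card (E `` {z} \<inter> H))
    + int (\<Sum>z\<in>Out. card (E `` {z} \<inter> Out))"
    using s(1) by linarith
  \<comment> \<open>The product is f(2t - 2) - f(h).\<close>
  have "0 \<le> (2 * int t - 2 - int ?h) * (2 * int n - 1 - (2 * int t - 2 + int ?h))"
    using j n_ge t2 by (intro mult_nonneg_nonneg) auto
  then have "int ?h * int ?h - int ?h + 2 * ((int n - int ?h) * int ?h) \<le> (2 * int t - 2) * (2 * int n - 2 * int t + 1)"
    by (simp add: algebra_simps)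
  with 1 2 3 have "int (\<Sum>i<n. d i) \<le> (2 * int t - 2) * (2 * int n - 2 * int t + 1) + int (\<Sum>z\<in>Out. card (E `` {z} \<inter> Out))"
    by linarith
  then show ?thesis using sum_large_int by (simp add: algebra_simps del: of_nat_sum)
qed

text \<open>Non-hubs have degree at most 3t - 2. Every arc within \<open>Out\<close> starts in the
  closed neighbourhood of x, ends in that of y, or has both ends below 3t; so the number of arcs is
  quadratic in t, while \<open>many_outer_arcs\<close> demands almost 2n.\<close>

theorem cocktail_join_subset: "U \<subseteq> E"
proof (rule ccontr)
  assume "\<not> ?thesis"
  then obtain u v where hole: "(u, v) \<in> U - E" by auto
  have uv: "u < 3 * t" "v < 3 * t" "u \<noteq> v" "u < n" "v < n" using hole U_lt n_ge by force+
  have hole': "(v, u) \<in> U - E" using hole U_sym edge_sym by blast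
  obtain x y where x: "x \<in> excess u" and y: "y \<in> excess v"
    using excess_nonempty[OF hole] excess_nonempty[OF hole'] uv finite_U_Image deg_ge_U by blast
  have outer: "w \<in> Out" if "w \<in> excess q" "q < 3 * t" for w q
  proof -
    have "(q, w) \<in> E" "(q, w) \<notin> U" "w \<noteq> q" using that by (auto simp: excess_iff)
    then show ?thesis using edge_in[of q w] that n_ge by (auto simp: cocktail_join_def)
  qed
  have xy: "x \<in> Out" "y \<in> Out" using outer x y uv by blast+
  define A where "A = insert x (E `` {x}) \<inter> Out"
  define B where "B = insert y (E `` {y}) \<inter> Out"
  have nbhd: "card (insert z (E `` {z}) \<inter> Out) \<le> 3 * t - 1" if "z \<in> Out" for z
  proof -
    have "card (insert z (E `` {z}) \<inter> Out) \<le> card (insert z (E `` {z}))" by (intro card_mono) auto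
    also have "\<dots> \<le> d z + 1" using deg[of z] that by (simp add: card_insert_if)
    finally show ?thesis using non_hubs[of z] that by simp
  qed
  have sub: "E \<inter> Out \<times> Out \<subseteq> (E \<inter> A \<times> Out) \<union> (E \<inter> Out \<times> B) \<union> {2 * t - j..<3 * t} \<times> {2 * t - j..<3 * t}"
  proof
    fix e assume "e \<in> E \<inter> Out \<times> Out"
    then obtain z w where e: "e = (z, w)" "(z, w) \<in> E" "z \<in> Out" "w \<in> Out" by auto
    show "e \<in> (E \<inter> A \<times> Out) \<union> (E \<inter> Out \<times> B) \<union> {2 * t - j..<3 * t} \<times> {2 * t - j..<3 * t}"
    proof (cases "(z, w) \<in> U")
      case True
      then show ?thesis using e U_lt by auto
    next
      case False
      then have "(x, z) \<in> E \<or> x = z \<or> (y, w) \<in> E \<or> y = w"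
        using three_switch_blocked[OF hole uv(3), of x y z w] x y e by (auto simp: excess_iff)
      then show ?thesis using e by (auto simp: A_def B_def)
    qed
  qed
  have arcs: "card (E \<inter> C \<times> Out) \<le> (3 * t - 1) * (3 * t - 2)" if "C \<subseteq> Out" "card C \<le> 3 * t - 1" for C
  proof -
    have fin: "finite C" using that finite_subset by blast
    have "card (E \<inter> C \<times> Out) = (\<Sum>z\<in>C. card (E `` {z} \<inter> Out))" by (rule card_Int_Times_sum[OF fin fin_E])
    also have "\<dots> \<le> (\<Sum>z\<in>C. 3 * t - 2)"
    proof (rule sum_mono)
      fix z assume z: "z \<in> C"
      have "card (E `` {z} \<inter> Out) \<le> card (E `` {z})" by (intro card_mono) auto
      then show "card (E `` {z} \<inter> Out) \<le> 3 * t - 2"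
        using deg[of z] non_hubs[of z] z that by force
    qed
    also have "\<dots> \<le> (3 * t - 1) * (3 * t - 2)" using that by simp
    finally show ?thesis .
  qed
  have "(\<Sum>z\<in>Out. card (E `` {z} \<inter> Out)) = card (E \<inter> Out \<times> Out)"
    by (rule card_Int_Times_sum[symmetric]) (auto simp: fin_E)
  also have "\<dots> \<le> card ((E \<inter> A \<times> Out) \<union> (E \<inter> Out \<times> B) \<union> {2 * t - j..<3 * t} \<times> {2 * t - j..<3 * t})"
    using sub fin_E by (intro card_mono) auto
  also have "\<dots> \<le> card (E \<inter> A \<times> Out) + card (E \<inter> Out \<times> B) + card ({2 * t - j..<3 * t} \<times> {2 * t - j..<3 * t})"
    by (intro order.trans[OF card_Un_le] add_mono card_Un_le) auto
  also have "card (E \<inter> Out \<times> B) = card (E \<inter> B \<times> Out)"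
    using simple by (intro card_Int_Times_swap) (simp add: simple_graph_onD)
  also have "card (E \<inter> A \<times> Out) \<le> (3 * t - 1) * (3 * t - 2)"
    using nbhd[OF xy(1)] by (intro arcs) (auto simp: A_def)
  also have "card (E \<inter> B \<times> Out) \<le> (3 * t - 1) * (3 * t - 2)"
    using nbhd[OF xy(2)] by (intro arcs) (auto simp: B_def)
  also have "card ({2 * t - j..<3 * t} \<times> {2 * t - j..<3 * t}) \<le> (2 * t) * (2 * t)"
    unfolding card_cartesian_product using j by (intro mult_mono) auto
  finally have "int (\<Sum>z\<in>Out. card (E `` {z} \<inter> Out)) \<le>
      int ((3 * t - 1) * (3 * t - 2) + (3 * t - 1) * (3 * t - 2) + (2 * t) * (2 * t))"
    by (simp only: of_nat_le_iff)
  also have "\<dots> = 2 * ((3 * int t - 1) * (3 * int t - 2)) + 4 * (int t * int t)"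
    using t2 by (simp add: of_nat_diff)
  also have "\<dots> = 22 * (int t * int t) - 18 * int t + 4"
    by (simp add: algebra_simps)
  finally have "int (\<Sum>z\<in>Out. card (E `` {z} \<inter> Out)) \<le> \<dots>" .
  moreover have "2 * int t \<le> int t * int t" using t2 by (intro mult_right_mono) auto
  ultimately show False using many_outer_arcs n_large_int t2 unfolding mult.assoc by linarith
qed

end

lemma sym_hub_join: "sym (hub_join t)"
  by (auto simp: hub_join_def sym_def)

lemma sym_cocktail_join: "sym (cocktail_join t j)"
  by (auto simp: cocktail_join_def sym_def)

section \<open>A realization containing one of the universal graphs\<close>

context dense_sequence
begin

text \<open>With at most t - 1 large degrees the sum would be at most n(t - 1) + n(3t - 2). This
  gives \<open>j \<le> t\<close> below.\<close>

lemma card_large_degrees: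
  assumes "realizes {..<n} d E" "h \<le> n" "\<And>i. h \<le> i \<Longrightarrow> i < n \<Longrightarrow> d i < 3 * t - 1"
  shows "t \<le> h"
proof (rule ccontr)
  assume h: "\<not> ?thesis"
  have deg: "d i \<le> n" if "i < n" for i
  proof -
    have "E `` {i} \<subseteq> {..<n}" "card (E `` {i}) = d i"
      using assms(1) that by (auto simp: realizes_def simple_graph_on_def)
    then show ?thesis by (metis card_lessThan card_mono finite_lessThan)
  qed
  have "(\<Sum>i<n. d i) \<le> (\<Sum>i<n. (if i < h then n else 0) + (3 * t - 2))"
  proof (rule sum_mono)
    fix i assume "i \<in> {..<n}"
    then show "d i \<le> (if i < h then n else 0) + (3 * t - 2)"
      using deg[of i] assms(3)[of i] by (cases "i < h") auto
  qed
  also have "\<dots> = h * n + n * (3 * t - 2)"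
  proof -
    have "{..<n} \<inter> {i. i < h} = {..<h}" using assms(2) by auto
    then show ?thesis by (simp add: sum.distrib sum.If_cases)
  qed
  also have "h * n \<le> (t - 1) * n" using h by (intro mult_right_mono) auto
  finally have "int (\<Sum>i<n. d i) \<le> int ((t - 1) * n + n * (3 * t - 2))"
    unfolding of_nat_le_iff by simp
  also have "\<dots> = 4 * (int t * int n) - 3 * int n" using t2 by (simp add: of_nat_diff algebra_simps)
  finally have "int (\<Sum>i<n. d i) \<le> \<dots>" .
  moreover have "2 * int t \<le> int t * int t" using t2 by (intro mult_right_mono) auto
  ultimately show False using sum_large_int n_large_int t2 unfolding mult.assoc by linarith
qed

text \<open>In the clique case f enumerates a clique on 3t vertices; otherwise it is the
  identity.\<close>

lemma ex_universal_realization: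
  assumes "realizes {..<n} d E0"
  obtains E f where "realizes {..<n} d E" "inj_on f {..<3 * t}" "f ` {..<3 * t} \<subseteq> {..<n}"
    "(\<forall>(i, k) \<in> hub_join t. (f i, f k) \<in> E) \<or>
      (\<exists>j. 2 \<le> j \<and> j \<le> t \<and> (\<forall>(i, k) \<in> cocktail_join t j. (f i, f k) \<in> E))"
proof -
  have id: "inj_on id {..<3 * t}" "id ` {..<3 * t} \<subseteq> {..<n}" using n_ge by auto
  show thesis
  proof (cases "3 * t - 1 \<le> d (2 * t - 2)")
    case hubs: True
    obtain E where E: "maximal_realization {..<n} d (hub_join t) E"
      using ex_maximal_realization[OF assms sym_hub_join] by blast
    then have R: "realizes {..<n} d E" by (rule maximal_realization.realizes)
    show thesis
    proof (cases "\<exists>C \<subseteq> {..<n}. card C = 3 * t \<and> (\<forall>x\<in>C. \<forall>y\<in>C. x \<noteq> y \<longrightarrow> (x, y) \<in> E)")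
      case True
      then obtain C where C: "C \<subseteq> {..<n}" "card C = 3 * t" "\<And>x y. x \<in> C \<Longrightarrow> y \<in> C \<Longrightarrow> x \<noteq> y \<Longrightarrow> (x, y) \<in> E"
        by blast
      have "finite C" using C(1) finite_subset by blast
      then obtain f where f: "bij_betw f {..<3 * t} C"
        using ex_bij_betw_nat_finite[of C] C(2) by (auto simp: atLeast0LessThan)
      have "(f i, f k) \<in> E" if "(i, k) \<in> hub_join t" for i k
      proof -
        have "i \<in> {..<3 * t}" "k \<in> {..<3 * t}" "i \<noteq> k" using that by (auto simp: hub_join_def)
        then show ?thesis using f by (intro C(3)) (auto simp: bij_betw_def inj_on_eq_iff)
      qed
      then show thesis using f C(1) R by (intro that[of E f]) (auto simp: bij_betw_def)
    next
      case False
      have "hub_sequence n t d E"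
        using E hubs False dense_sequence_axioms
        by (auto simp: hub_sequence_def hub_sequence_axioms_def)
      then have "hub_join t \<subseteq> E" by (rule hub_sequence.hub_join_subset)
      then show thesis using R id by (intro that[of E id]) auto
    qed
  next
    case False
    \<comment> \<open>By sortedness h is the number of hubs, and j is then chosen with
      \<open>2 * t - j = h\<close>.\<close>
    define h where "h = (LEAST i. d i < 3 * t - 1)"
    have h: "d h < 3 * t - 1" "h \<le> 2 * t - 2"
      unfolding h_def using False LeastI[of "\<lambda>i. d i < 3 * t - 1" "2 * t - 2"] Least_le[of "\<lambda>i. d i < 3 * t - 1" "2 * t - 2"]
      by auto
    have below: "3 * t - 1 \<le> d i" if "i < h" for i
      using not_less_Least[of i "\<lambda>i. d i < 3 * t - 1"] that by (simp add: h_def)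
    have above: "d i < 3 * t - 1" if "h \<le> i" "i < n" for i using sorted[OF that] h by simp
    have "t \<le> h" using card_large_degrees[OF assms _ above] h n_ge t2 by auto
    define j where "j = 2 * t - h"
    have j: "2 \<le> j" "j \<le> t" "2 * t - j = h" using h \<open>t \<le> h\<close> t2 by (auto simp: j_def)
    obtain E where E: "maximal_realization {..<n} d (cocktail_join t j) E"
      using ex_maximal_realization[OF assms sym_cocktail_join] by blast
    then have R: "realizes {..<n} d E" by (rule maximal_realization.realizes)
    have "few_hubs_sequence n t j d E"
      using E j below above dense_sequence_axioms
      by (auto simp: few_hubs_sequence_def few_hubs_sequence_axioms_def)
    then have "cocktail_join t j \<subseteq> E" by (rule few_hubs_sequence.cocktail_join_subset)
    then show thesis using R id j by (intro that[of E id]) auto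
  qed
qed

end

section \<open>Orderings of graphs with a forest 3-colouring\<close>

lemma Suc_of_div2_eq: "p < q \<Longrightarrow> p div 2 = q div 2 \<Longrightarrow> q = p + 1" for p q :: nat
  by presburger

text \<open>Arcs count edges twice, so \<open>forest\<close> bounds the edges spanned by X by card X
  - 1. The smallest class B will lie entirely among the hubs.\<close>

locale forest_classes =
  fixes T :: "('a \<times> 'a) set" and V A B C :: "'a set"
  assumes T: "simple_graph_on V T"
    and V: "V = A \<union> B \<union> C" "A \<inter> B = {}" "A \<inter> C = {}" "B \<inter> C = {}"
    and indep: "T \<inter> A \<times> A = {}" "T \<inter> C \<times> C = {}"
    and forest: "\<And>X. X \<subseteq> A \<union> C \<Longrightarrow> X \<noteq> {} \<Longrightarrow> card (T \<inter> X \<times> X) + 2 \<le> 2 * card X"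
    and class_le: "card A \<le> card C" "card B \<le> card A"
begin

lemma fin: "finite V" "finite A" "finite B" "finite C" "finite T"
  using T V simple_graph_onD by (metis finite_Un)+

lemma T_sym: "(x, y) \<in> T \<Longrightarrow> (y, x) \<in> T"
  using simple_graph_onD(7)[OF T] .

lemma card_arcs_between:
  assumes "A1 \<subseteq> A" "C1 \<subseteq> C" "A1 \<union> C1 \<noteq> {}"
  shows "card (T \<inter> A1 \<times> C1) + 1 \<le> card A1 + card C1"
proof -
  have f: "finite A1" "finite C1" using assms fin finite_subset by blast+
  have "T \<inter> (A1 \<union> C1) \<times> (A1 \<union> C1) = (T \<inter> A1 \<times> C1) \<union> (T \<inter> C1 \<times> A1)"
    using indep assms by blast
  moreover have "card ((T \<inter> A1 \<times> C1) \<union> (T \<inter> C1 \<times> A1)) = card (T \<inter> A1 \<times> C1) + card (T \<inter> C1 \<times> A1)"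
    using fin assms V by (intro card_Un_disjoint) auto
  moreover have "card (T \<inter> C1 \<times> A1) = card (T \<inter> A1 \<times> C1)"
    using T by (intro card_Int_Times_swap) (simp add: simple_graph_onD)
  moreover have "card (A1 \<union> C1) = card A1 + card C1"
    using f assms V by (intro card_Un_disjoint) auto
  ultimately show ?thesis using forest[of "A1 \<union> C1"] assms by force
qed

text \<open>Greedy choice: a vertex of least degree in what remains of the forest after deleting \<open>W\<close>
  and its neighbours increases \<open>card (T `` W \<inter> C) - card W\<close> by too little to exceed the bound.\<close>

lemma ex_small_neighbourhood:
  "w \<le> card A \<Longrightarrow> \<exists>W \<subseteq> A. card W = w \<and> card (T `` W \<inter> C) + card A \<le> w + card C"
proof (induction w)
  case 0
  show ?case using class_le by (intro exI[of _ "{}"]) auto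
next
  case (Suc w)
  then obtain W where W: "W \<subseteq> A" "card W = w" "card (T `` W \<inter> C) + card A \<le> w + card C" by auto
  define A1 where "A1 = A - W"
  define C1 where "C1 = C - T `` W"
  have f: "finite A1" "finite C1" "finite W" using fin W finite_subset by (auto simp: A1_def C1_def)
  have cA1: "card A1 = card A - w" unfolding A1_def using W f by (simp add: card_Diff_subset)
  then have ne: "A1 \<noteq> {}" using Suc.prems f by auto
  have cC1: "card C1 + card (T `` W \<inter> C) = card C"
  proof -
    have "C1 = C - (T `` W \<inter> C)" by (auto simp: C1_def)
    then have "card C1 = card C - card (T `` W \<inter> C)" using fin by (simp add: card_Diff_subset)
    moreover have "card (T `` W \<inter> C) \<le> card C" using fin by (intro card_mono) auto
    ultimately show ?thesis by simp
  qed
  \<comment> \<open>k is the slack of the induction hypothesis, so C1 has k more elements than A1.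
    If each vertex of A1 had k + 2 neighbours in C1, the forest would have at least as many edges as
    vertices.\<close>
  define k where "k = w + card C - (card (T `` W \<inter> C) + card A)"
  have "\<exists>a\<in>A1. card (T `` {a} \<inter> C1) \<le> k + 1"
  proof (rule ccontr)
    assume "\<not> ?thesis"
    then have "(\<Sum>a\<in>A1. k + 2) \<le> (\<Sum>a\<in>A1. card (T `` {a} \<inter> C1))" by (intro sum_mono) auto
    also have "\<dots> = card (T \<inter> A1 \<times> C1)" using card_Int_Times_sum[OF f(1) fin(5)] by simp
    finally have "card A1 * (k + 2) + 1 \<le> card A1 + card C1"
      using card_arcs_between[of A1 C1] ne by (auto simp: A1_def C1_def)
    moreover have "card C1 = card A1 + k" using cC1 cA1 W Suc.prems by (simp add: k_def)
    moreover have "card A1 > 0" using ne f by auto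
    then have "k \<le> card A1 * k" by simp
    ultimately show False unfolding add_mult_distrib2 by linarith
  qed
  then obtain a where a: "a \<in> A1" "card (T `` {a} \<inter> C1) \<le> k + 1" by blast
  have "card (T `` insert a W \<inter> C) \<le> card ((T `` W \<inter> C) \<union> (T `` {a} \<inter> C1))"
    using fin f by (intro card_mono) (auto simp: C1_def)
  also have "\<dots> \<le> card (T `` W \<inter> C) + (k + 1)" using card_Un_le a(2) add_left_mono order.trans by metis
  finally have "card (T `` insert a W \<inter> C) + card A \<le> Suc w + card C" using W by (simp add: k_def)
  moreover have "card (insert a W) = Suc w" using a W f by (simp add: A1_def)
  moreover have "insert a W \<subseteq> A" using a W by (auto simp: A1_def)
  ultimately show ?case by blast
qed

text \<open>W is taken from A, and Q, containing all neighbours of W in C, and Z from C; the rest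
  forms L. The last conclusion supplies a non-edge for a cocktail pair with one vertex in W and one
  in Q.\<close>

lemma ex_decomposition:
  assumes card_V: "card V = 3 * t" and j: "1 \<le> j" "j \<le> t"
  obtains L W Q Z where "V = L \<union> W \<union> Q \<union> Z" "finite L" "finite W" "finite Q" "finite Z"
    "L \<inter> W = {}" "L \<inter> Q = {}" "L \<inter> Z = {}" "W \<inter> Q = {}" "W \<inter> Z = {}" "Q \<inter> Z = {}"
    "card L = 2 * t - j" "card W \<le> j" "card W + card Q = 2 * j" "card Z = t - j"
    "T \<inter> (W \<union> Q \<union> Z) \<times> (W \<union> Q \<union> Z) \<subseteq> W \<times> Q \<union> Q \<times> W"
    "W \<noteq> {} \<and> 2 \<le> j \<longrightarrow> (\<exists>p\<in>W. \<exists>q\<in>Q. (p, q) \<notin> T)"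
proof -
  have cV: "card A + card B + card C = 3 * t"
    using V fin card_V by (simp add: card_Un_disjoint Int_Un_distrib2)
  have tC: "t \<le> card C" using cV class_le by linarith
  define e where "e = card C - t"
  have e: "card C = t + e" "2 * t \<le> 2 * card A + e" using tC cV class_le by (auto simp: e_def)
  \<comment> \<open>If the surplus e of C over t is at least j, truncation gives w = 0 and C alone
    provides Q and Z.\<close>
  define w where "w = j - e"
  have "w \<le> card A" using e j by (simp add: w_def)
  then obtain W where W: "W \<subseteq> A" "card W = w" "card (T `` W \<inter> C) + card A \<le> w + card C"
    using ex_small_neighbourhood by blast
  \<comment> \<open>For w > 0 the bound w + card C - card A is j + t - card A, at most j + e = 2j -
    w because \<open>2 * t \<le> 2 * card A + e\<close>.\<close>
  have small: "card (T `` W \<inter> C) \<le> 2 * j - w"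
  proof (cases "w = 0")
    case True
    then have "W = {}" using W fin finite_subset by (metis card_0_eq)
    then show ?thesis by simp
  next
    case False
    then show ?thesis using W(3) e j by (simp add: w_def)
  qed
  have Qle: "2 * j - w + (t - j) \<le> card C" using e j by (auto simp: w_def)
  obtain Q where Q: "T `` W \<inter> C \<subseteq> Q" "Q \<subseteq> C" "card Q = 2 * j - w"
    using exists_subset_between[OF small, of C] Qle fin by auto
  have fQ: "finite Q" "finite W" using Q W fin finite_subset by blast+
  have "t - j \<le> card (C - Q)" using Q fQ Qle by (simp add: card_Diff_subset)
  then obtain Z where Z: "Z \<subseteq> C - Q" "card Z = t - j" "finite Z"
    using obtain_subset_with_card_n by metis
  define L where "L = V - (W \<union> Q \<union> Z)"
  have sub: "W \<union> Q \<union> Z \<subseteq> V" using W Q Z V by blast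
  have disj: "W \<inter> Q = {}" "W \<inter> Z = {}" "Q \<inter> Z = {}" using W Q Z V by blast+
  have "card (W \<union> Q \<union> Z) = w + (2 * j - w) + (t - j)"
    using disj fQ Z W Q by (simp add: card_Un_disjoint Int_Un_distrib2)
  moreover have wj: "w \<le> j" by (simp add: w_def)
  ultimately have cL: "card L = 2 * t - j"
    unfolding L_def using sub fQ Z card_V j by (simp add: card_Diff_subset)
  have arcs: "T \<inter> (W \<union> Q \<union> Z) \<times> (W \<union> Q \<union> Z) \<subseteq> W \<times> Q \<union> Q \<times> W"
  proof -
    have "T \<inter> W \<times> W = {}" "T \<inter> (Q \<union> Z) \<times> (Q \<union> Z) = {}" using indep W Q Z by blast+
    moreover have "T \<inter> W \<times> Z = {}" using Q(1) Z V by blast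
    moreover have "T \<inter> Z \<times> W = {}" using Q(1) Z V T_sym by blast
    ultimately show ?thesis by blast
  qed
  \<comment> \<open>If W and Q were completely joined, the forest bound would force w = 1, and W
    would have 2j - 1 neighbours in C, more than its choice allows.\<close>
  have "\<exists>p\<in>W. \<exists>q\<in>Q. (p, q) \<notin> T" if "W \<noteq> {}" "2 \<le> j"
  proof (rule ccontr)
    assume "\<not> ?thesis"
    then have all: "W \<times> Q \<subseteq> T" by auto
    have w0: "0 < w" using that W fQ by auto
    have "T \<inter> W \<times> Q = W \<times> Q" using all by auto
    then have le: "w * card Q + 1 \<le> w + card Q"
      using card_arcs_between[of W Q] W Q that by (simp add: card_cartesian_product)
    have cQ: "card Q = 2 * j - w" "2 \<le> card Q" using Q wj that by auto
    have "w = 1"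
    proof (rule ccontr)
      assume "w \<noteq> 1"
      then have "2 * card Q \<le> w * card Q" "w \<le> card Q" using w0 wj cQ by (auto intro: mult_right_mono)
      with le show False by simp
    qed
    then have "e + 1 = j" by (auto simp: w_def)
    moreover have "Q \<subseteq> T `` W \<inter> C" using all that Q by blast
    then have "card Q \<le> card (T `` W \<inter> C)" using fin by (intro card_mono) auto
    ultimately show False using cQ W(3) e \<open>w = 1\<close> that by linarith
  qed
  moreover have "V = L \<union> W \<union> Q \<union> Z" "L \<inter> W = {}" "L \<inter> Q = {}" "L \<inter> Z = {}" "finite L"
    using sub fin by (auto simp: L_def)
  ultimately show thesis
    using that[of L W Q Z] fQ Z disj cL W Q wj arcs by auto
qed

text \<open>L, W, Q, Z are listed in this order. Cocktail pairs are consecutive positions, so only a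
  pair straddling W and Q could be an edge of T; the last vertex of W and the first of Q are chosen
  non-adjacent. For \<open>j = 1\<close> the two vertices of \<open>W \<union> Q\<close> are the
  ends of the spare edge.\<close>

lemma ex_ordering:
  assumes card_V: "card V = 3 * t" and j: "1 \<le> j" "j \<le> t"
  obtains g where "bij_betw g {..<3 * t} V"
    "\<And>i k. i < 3 * t \<Longrightarrow> k < 3 * t \<Longrightarrow> (g i, g k) \<in> T \<Longrightarrow>
      (i, k) \<in> (if j = 1 then hub_join t else cocktail_join t j)"
proof -
  obtain L W Q Z where dec: "V = L \<union> W \<union> Q \<union> Z" "finite L" "finite W" "finite Q" "finite Z"
    "L \<inter> W = {}" "L \<inter> Q = {}" "L \<inter> Z = {}" "W \<inter> Q = {}" "W \<inter> Z = {}" "Q \<inter> Z = {}"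
    and card: "card L = 2 * t - j" "card W \<le> j" "card W + card Q = 2 * j" "card Z = t - j"
    and arcs: "T \<inter> (W \<union> Q \<union> Z) \<times> (W \<union> Q \<union> Z) \<subseteq> W \<times> Q \<union> Q \<times> W"
    and pair: "W \<noteq> {} \<and> 2 \<le> j \<longrightarrow> (\<exists>p\<in>W. \<exists>q\<in>Q. (p, q) \<notin> T)"
    by (rule ex_decomposition[OF assms]; rule that; assumption)
  obtain ls where ls: "set ls = L" "distinct ls" using finite_distinct_list dec(2) by blast
  obtain zs where zs: "set zs = Z" "distinct zs" using finite_distinct_list dec(5) by blast
  obtain ws qs where wq: "set ws = W" "distinct ws" "set qs = Q" "distinct qs"
    "ws \<noteq> [] \<Longrightarrow> 2 \<le> j \<Longrightarrow> qs \<noteq> [] \<and> (last ws, hd qs) \<notin> T"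
  proof (cases "W \<noteq> {} \<and> 2 \<le> j")
    case True
    then obtain p q where pq: "p \<in> W" "q \<in> Q" "(p, q) \<notin> T" using pair by blast
    obtain ws where "set ws = W - {p}" "distinct ws" using finite_distinct_list dec(3) by blast
    moreover obtain qs where "set qs = Q - {q}" "distinct qs" using finite_distinct_list dec(4) by blast
    ultimately show thesis using pq by (intro that[of "ws @ [p]" "q # qs"]) auto
  next
    case False
    obtain ws where "set ws = W" "distinct ws" using finite_distinct_list dec(3) by blast
    moreover obtain qs where "set qs = Q" "distinct qs" using finite_distinct_list dec(4) by blast
    ultimately show thesis using False by (intro that[of ws qs]) auto
  qed
  define w where "w = card W"
  define h where "h = 2 * t - j"
  define xs where "xs = ls @ ws @ qs @ zs"
  have len: "length ls = h" "length ws = w" "length qs = 2 * j - w" "length zs = t - j"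
    using ls zs wq card by (auto simp: distinct_card[symmetric] h_def w_def)
  have wj: "w \<le> j" "h + j = 2 * t" using card j by (auto simp: w_def h_def)
  have xs: "distinct xs" "set xs = V" "length xs = 3 * t"
    using ls zs wq dec len wj j by (auto simp: xs_def)
  define g where "g = (\<lambda>i. xs ! i)"
  have bij: "bij_betw g {..<3 * t} V"
    unfolding g_def using bij_betw_nth[OF xs(1), of "{..<3 * t}" V] xs by simp
  have pos: "g i \<in> W \<and> g i = ws ! (i - h)" if "h \<le> i" "i < h + w" for i
    using that len wq(1) by (auto simp: g_def xs_def nth_append)
  have posQ: "g i \<in> Q \<and> g i = qs ! (i - h - w)" if "h + w \<le> i" "i < h + 2 * j" for i
    using that len wq(3) wj by (auto simp: g_def xs_def nth_append)
  have posZ: "g i \<in> Z" if "h + 2 * j \<le> i" "i < 3 * t" for i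
    using that len zs(1) wj by (auto simp: g_def xs_def nth_append)
  have rest: "g i \<in> W \<union> Q \<union> Z" if "h \<le> i" "i < 3 * t" for i
  proof -
    consider "i < h + w" | "h + w \<le> i" "i < h + 2 * j" | "h + 2 * j \<le> i" by linarith
    then show ?thesis
    proof cases
      case 1
      then have "g i \<in> W" using pos[of i] that by blast
      then show ?thesis by simp
    next
      case 2
      then have "g i \<in> Q" using posQ[of i] by blast
      then show ?thesis by simp
    next
      case 3
      then have "g i \<in> Z" using posZ[of i] that by blast
      then show ?thesis by simp
    qed
  qed
  have inW: "i < h + w" if "g i \<in> W" "h \<le> i" "i < 3 * t" for i
    using posQ[of i] posZ[of i] that dec(9,10) by (meson disjoint_iff not_le)
  have inQ: "h + w \<le> i \<and> i < h + 2 * j" if "g i \<in> Q" "h \<le> i" "i < 3 * t" for i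
    using pos[of i] posZ[of i] that dec(9,11) by (meson disjoint_iff not_le)
  have key: "i < h + w \<and> h + w \<le> k \<and> k < h + 2 * j \<and> (2 \<le> j \<longrightarrow> (i - h) div 2 \<noteq> (k - h) div 2)"
    if ik: "g i \<in> W" "g k \<in> Q" "h \<le> i" "h \<le> k" "i < 3 * t" "k < 3 * t" "(g i, g k) \<in> T" for i k
  proof -
    have b: "i < h + w" "h + w \<le> k" "k < h + 2 * j" using inW[of i] inQ[of k] ik by auto
    moreover have False if "2 \<le> j" "(i - h) div 2 = (k - h) div 2"
    proof -
      have "i - h < k - h" using b ik(3) by simp
      then have "k - h = i - h + 1" using that(2) by (rule Suc_of_div2_eq)
      then have ik': "i - h = w - 1" "k = h + w" using b ik(3) by linarith+
      have "ws \<noteq> []" using b ik(3) len by auto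
      then have "(last ws, hd qs) \<notin> T" "qs \<noteq> []" using wq(5) that(1) by auto
      moreover have "g i = last ws" using pos[of i] b ik(3) ik' len \<open>ws \<noteq> []\<close> by (simp add: last_conv_nth)
      moreover have "g k = hd qs" using posQ[of k] b ik' \<open>qs \<noteq> []\<close> by (simp add: hd_conv_nth)
      ultimately show False using ik(7) by simp
    qed
    ultimately show ?thesis by blast
  qed
  have "(i, k) \<in> (if j = 1 then hub_join t else cocktail_join t j)"
    if ik: "i < 3 * t" "k < 3 * t" "(g i, g k) \<in> T" for i k
  proof -
    have ne: "i \<noteq> k" using ik simple_graph_onD(8)[OF T] by auto
    show ?thesis
    proof (cases "i < h \<or> k < h")
      case True
      then show ?thesis using ne ik by (auto simp: hub_join_def cocktail_join_def h_def)
    next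
      case False
      then have hk: "h \<le> i" "h \<le> k" by auto
      have "(g i, g k) \<in> W \<times> Q \<union> Q \<times> W" using arcs rest[OF hk(1)] rest[OF hk(2)] ik by blast
      then have "i < h + 2 * j \<and> k < h + 2 * j \<and> (2 \<le> j \<longrightarrow> (i - h) div 2 \<noteq> (k - h) div 2)"
      proof
        assume "(g i, g k) \<in> W \<times> Q"
        then show ?thesis using key[of i k] hk ik wj by auto
      next
        assume "(g i, g k) \<in> Q \<times> W"
        then show ?thesis using key[of k i] hk ik wj T_sym by auto
      qed
      moreover have "h + 2 * j = 2 * t + j" using wj by simp
      ultimately show ?thesis
        using ne ik j by (auto simp: hub_join_def cocktail_join_def h_def)
    qed
  qed
  with bij show thesis by (rule that)
qed

end

section \<open>2-trees\<close>

lemma graph_simple_graph_on: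
  assumes "graph G"
  shows "simple_graph_on (verts G) (arcs_ends G)"
proof -
  interpret graph G by fact
  show ?thesis
    unfolding simple_graph_on_def
    using sym_arcs no_loops by (auto simp: symmetric_def arcs_ends_conv irrefl_def)
qed

lemma graph_out_degree:
  assumes "graph G"
  shows "out_degree G v = card (arcs_ends G `` {v})"
proof -
  interpret graph G by fact
  have "head G ` out_arcs G v = arcs_ends G `` {v}"
    by (force simp: out_arcs_def arcs_ends_conv)
  moreover have "inj_on (head G) (out_arcs G v)"
    using no_multi_arcs by (auto simp: inj_on_def out_arcs_def arc_to_ends_def)
  ultimately show ?thesis unfolding out_degree_def by (metis card_image)
qed

section \<open>Forest 3-colourings of 2-trees\<close>

lemma arcs_ends_del_vert:
  "arcs_ends (pre_digraph.del_vert G v) = arcs_ends G \<inter> (- {v}) \<times> (- {v})"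
  by (auto simp: arcs_ends_conv pre_digraph.del_vert_simps)

text \<open>A set omitting a colour lies in two colour classes, so the last clause says that any two
  classes induce a forest, in a form that passes to subsets.\<close>

definition forest_colouring :: "'a set \<Rightarrow> ('a \<times> 'a) set \<Rightarrow> ('a \<Rightarrow> nat) \<Rightarrow> bool" where
  "forest_colouring V T c \<longleftrightarrow> c ` V \<subseteq> {..<3} \<and> (\<forall>(x, y)\<in>T. c x \<noteq> c y) \<and>
    (\<forall>q<3. \<forall>X\<subseteq>V. X \<noteq> {} \<longrightarrow> q \<notin> c ` X \<longrightarrow> card (T \<inter> X \<times> X) + 2 \<le> 2 * card X)"

lemma forest_colouringI:
  assumes "c ` V \<subseteq> {..<3}" "\<And>x y. (x, y) \<in> T \<Longrightarrow> c x \<noteq> c y"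
    "\<And>q X. q < 3 \<Longrightarrow> X \<subseteq> V \<Longrightarrow> X \<noteq> {} \<Longrightarrow> q \<notin> c ` X \<Longrightarrow> card (T \<inter> X \<times> X) + 2 \<le> 2 * card X"
  shows "forest_colouring V T c"
  using assms unfolding forest_colouring_def by blast

lemma forest_colouring_triangle:
  assumes "card V = 3"
  shows "\<exists>c. forest_colouring V {(u, v). u \<in> V \<and> v \<in> V \<and> u \<noteq> v} c"
proof -
  have fin: "finite V" using assms card.infinite by fastforce
  then obtain c where c: "bij_betw c V {..<3::nat}"
    using ex_bij_betw_finite_nat[of V] assms by (auto simp: atLeast0LessThan)
  have "forest_colouring V {(u, v). u \<in> V \<and> v \<in> V \<and> u \<noteq> v} c" (is "forest_colouring V ?T c")
  proof (rule forest_colouringI)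
    show "c ` V \<subseteq> {..<3}" "\<And>x y. (x, y) \<in> ?T \<Longrightarrow> c x \<noteq> c y"
      using c by (auto simp: bij_betw_def inj_on_def)
    fix q X assume q: "q < 3" and X: "X \<subseteq> V" "X \<noteq> {}" "q \<notin> c ` X"
    have finX: "finite X" using X fin finite_subset by blast
    have "card X = card (c ` X)" using c X by (metis bij_betw_def card_image inj_on_subset)
    also have "\<dots> \<le> card ({..<3} - {q})"
      using c X by (intro card_mono) (auto simp: bij_betw_def)
    finally have X2: "card X \<le> 2" using q by simp
    have "card (?T \<inter> X \<times> X) \<le> card (X \<times> X - (\<lambda>x. (x, x)) ` X)"
      using finX by (intro card_mono) auto
    also have "\<dots> = card X * card X - card X"
      using finX by (subst card_Diff_subset) (auto simp: card_cartesian_product card_image inj_on_def)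
    finally have "card (?T \<inter> X \<times> X) \<le> card X * card X - card X" .
    moreover have "card X = 1 \<or> card X = 2" using X2 X finX
      by (metis One_nat_def card_0_eq le_Suc_eq le_zero_eq numeral_2_eq_2)
    ultimately show "card (?T \<inter> X \<times> X) + 2 \<le> 2 * card X" by auto
  qed
  then show ?thesis by blast
qed

text \<open>The three colours 0, 1, 2 sum to 3, which gives the witness.\<close>

lemma third_colour:
  fixes p q :: nat
  assumes "p \<noteq> q" "p < 3" "q < 3"
  shows "\<exists>a<3. a \<noteq> p \<and> a \<noteq> q \<and> (\<forall>r<3. r \<noteq> a \<longrightarrow> r = p \<or> r = q)"
proof (intro exI[of _ "3 - p - q"] conjI allI impI)
  fix r assume "r < 3" "r \<noteq> 3 - p - q"
  then show "r = p \<or> r = q" using assms by linarith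
qed (use assms in presburger)+

text \<open>As x and y are adjacent, their colours differ and v takes the third. A set containing v
  and omitting a colour contains at most one of x and y, so v adds at most one edge to the
  forest.\<close>

lemma forest_colouring_extend:
  assumes T: "simple_graph_on V T" and v: "v \<in> V" and nbrs: "T `` {v} = {x, y}"
    and xy: "(x, y) \<in> T"
    and c: "forest_colouring (V - {v}) (T \<inter> (- {v}) \<times> (- {v})) c"
  shows "\<exists>c. forest_colouring V T c"
proof -
  note D = simple_graph_onD[OF T]
  have xv: "x \<noteq> v" "y \<noteq> v" "x \<noteq> y" "x \<in> V" "y \<in> V" using nbrs D(8,9) xy by blast+
  then have col: "c x \<noteq> c y" "c x < 3" "c y < 3"
    using c xy unfolding forest_colouring_def by auto
  then obtain a where a: "a < 3" "a \<noteq> c x" "a \<noteq> c y" "\<And>q. q < 3 \<Longrightarrow> q \<noteq> a \<Longrightarrow> q = c x \<or> q = c y"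
    using third_colour by metis
  have "forest_colouring V T (c(v := a))"
  proof (rule forest_colouringI)
    show "c(v := a) ` V \<subseteq> {..<3}"
      using c a(1) by (auto simp: forest_colouring_def)
    show "(c(v := a)) p \<noteq> (c(v := a)) q" if pq: "(p, q) \<in> T" for p q
    proof -
      have "(q, p) \<in> T" "p \<noteq> q" using pq D by blast+
      then show ?thesis using c pq nbrs a unfolding forest_colouring_def by (cases "p = v"; cases "q = v") force+
    qed
    fix q X assume q: "q < 3" and X: "X \<subseteq> V" "X \<noteq> {}" "q \<notin> c(v := a) ` X"
    have finX: "finite X" using X D finite_subset by blast
    have old: "card (T \<inter> Y \<times> Y) + 2 \<le> 2 * card Y" if "Y \<subseteq> X - {v}" "Y \<noteq> {}" for Y
    proof -
      have "q \<notin> c ` Y" "Y \<subseteq> V - {v}" using that X by auto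
      moreover have "T \<inter> (- {v}) \<times> (- {v}) \<inter> Y \<times> Y = T \<inter> Y \<times> Y" using that by blast
      ultimately show ?thesis using c q that(2) unfolding forest_colouring_def by metis
    qed
    show "card (T \<inter> X \<times> X) + 2 \<le> 2 * card X"
    proof (cases "v \<in> X")
      case False
      then show ?thesis using old[of X] X by auto
    next
      case True
      then have "q \<noteq> a" using X by auto
      then have "q = c x \<or> q = c y" using a q by blast
      then have "x \<notin> X \<or> y \<notin> X" using X xv by auto
      then obtain s where s: "T `` {v} \<inter> X \<subseteq> {s}" using nbrs by auto
      have cX: "card X = card (X - {v}) + 1" using card_Suc_Diff1[OF finX True] by simp
      show ?thesis
      proof (cases "X - {v} = {}")
        case True
        then have "T \<inter> X \<times> X = {}" using D(8) by auto
        then show ?thesis using X finX cX by simp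
      next
        case False
        have "T \<inter> X \<times> X \<subseteq> (T \<inter> (X - {v}) \<times> (X - {v})) \<union> {(v, s), (s, v)}"
          using s D(7) by blast
        then have "card (T \<inter> X \<times> X) \<le> card ((T \<inter> (X - {v}) \<times> (X - {v})) \<union> {(v, s), (s, v)})"
          using D(2) by (intro card_mono) auto
        also have "\<dots> \<le> card (T \<inter> (X - {v}) \<times> (X - {v})) + card {(v, s), (s, v)}" by (rule card_Un_le)
        also have "card {(v, s), (s, v)} \<le> 2" using card_length[of "[(v, s), (s, v)]"] by simp
        finally show ?thesis using old[of "X - {v}"] False cX by simp
      qed
    qed
  qed
  then show ?thesis by blast
qed

lemma two_tree_forest_colouring:
  assumes "two_tree G"
  shows "simple_graph_on (verts G) (arcs_ends G) \<and> (\<exists>c. forest_colouring (verts G) (arcs_ends G) c)"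
  using assms
proof (induction G rule: two_tree.induct)
  case (K3 G)
  then have G: "graph G" "card (verts G) = 3"
    "arcs_ends G = {(u, v). (u, v) \<in> verts G \<times> verts G \<and> u \<noteq> v}"
    by (auto simp: complete_digraph_def)
  then have "arcs_ends G = {(u, v). u \<in> verts G \<and> v \<in> verts G \<and> u \<noteq> v}" by auto
  then show ?case using forest_colouring_triangle[OF G(2)] graph_simple_graph_on[OF G(1)] by simp
next
  case (step G v x y)
  have S: "simple_graph_on (verts G) (arcs_ends G)" using graph_simple_graph_on[OF step(1)] .
  have xy: "(v, x) \<in> arcs_ends G" "(v, y) \<in> arcs_ends G" "(x, y) \<in> arcs_ends G" "x \<noteq> y"
    using step by auto
  have "card (arcs_ends G `` {v}) = 2" using graph_out_degree[OF step(1), of v] step by simp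
  moreover have "finite (arcs_ends G `` {v})" using simple_graph_onD(6)[OF S] .
  ultimately have nbrs: "arcs_ends G `` {v} = {x, y}"
    using xy card_subset_eq[of "arcs_ends G `` {v}" "{x, y}"] by auto
  obtain c where "forest_colouring (verts G - {v}) (arcs_ends G \<inter> (- {v}) \<times> (- {v})) c"
    using step.IH by (auto simp: arcs_ends_del_vert pre_digraph.verts_del_vert)
  then show ?case using forest_colouring_extend[OF S step(2) nbrs xy(3)] S by blast
qed

lemma sorted_three_classes:
  fixes f :: "nat \<Rightarrow> nat"
  obtains p q r where "{p, q, r} = {..<3}" "p \<noteq> q" "p \<noteq> r" "q \<noteq> r" "f q \<le> f p" "f r \<le> f q"
proof -
  have *: "{..<3} = {0, 1, 2::nat}" by auto
  consider "f 0 \<le> f 1" "f 1 \<le> f 2" | "f 0 \<le> f 2" "f 2 \<le> f 1" | "f 1 \<le> f 0" "f 0 \<le> f 2"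
    | "f 1 \<le> f 2" "f 2 \<le> f 0" | "f 2 \<le> f 0" "f 0 \<le> f 1" | "f 2 \<le> f 1" "f 1 \<le> f 0" by linarith
  then show thesis
  proof cases
    case 1 then show thesis by (intro that[of 2 1 0]) (auto simp: *)
  next
    case 2 then show thesis by (intro that[of 1 2 0]) (auto simp: *)
  next
    case 3 then show thesis by (intro that[of 2 0 1]) (auto simp: *)
  next
    case 4 then show thesis by (intro that[of 0 2 1]) (auto simp: *)
  next
    case 5 then show thesis by (intro that[of 1 0 2]) (auto simp: *)
  next
    case 6 then show thesis by (intro that[of 0 1 2]) (auto simp: *)
  qed
qed

lemma forest_colouring_forest_classes:
  assumes T: "simple_graph_on V T" and c: "forest_colouring V T c"
  obtains A B C where "forest_classes T V A B C"
proof -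
  obtain p q r where pqr: "{p, q, r} = {..<3}" "p \<noteq> q" "p \<noteq> r" "q \<noteq> r"
    "card {v \<in> V. c v = q} \<le> card {v \<in> V. c v = p}" "card {v \<in> V. c v = r} \<le> card {v \<in> V. c v = q}"
    by (rule sorted_three_classes[of "\<lambda>q. card {v \<in> V. c v = q}"])
  let ?cls = "\<lambda>q. {v \<in> V. c v = q}"
  \<comment> \<open>The largest class takes the place of C, the smallest that of B.\<close>
  have "forest_classes T V (?cls q) (?cls r) (?cls p)"
  proof
    show "V = ?cls q \<union> ?cls r \<union> ?cls p"
    proof -
      have "c v \<in> {p, q, r}" if "v \<in> V" for v
        using c that pqr(1) unfolding forest_colouring_def by blast
      then show ?thesis by auto
    qed
    show "T \<inter> ?cls q \<times> ?cls q = {}" "T \<inter> ?cls p \<times> ?cls p = {}"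
      using c unfolding forest_colouring_def by auto
    fix X assume X: "X \<subseteq> ?cls q \<union> ?cls p" "X \<noteq> {}"
    then have "r \<notin> c ` X" "X \<subseteq> V" "r < 3" using pqr by auto
    then show "card (T \<inter> X \<times> X) + 2 \<le> 2 * card X"
      using c X(2) unfolding forest_colouring_def by blast
  qed (use T pqr in auto)
  then show thesis by (rule that)
qed

section \<open>Translation between digraphs and edge relations\<close>

lemma contains_subgraph_pairI:
  assumes G: "pair_wf_digraph G" and T: "pair_wf_digraph T"
    and inj: "inj_on \<phi> (pverts T)" and verts: "\<phi> ` pverts T \<subseteq> pverts G"
    and arcs: "\<And>x y. (x, y) \<in> parcs T \<Longrightarrow> (\<phi> x, \<phi> y) \<in> parcs G"
  shows "contains_subgraph (with_proj G) (with_proj T)"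
proof -
  interpret T: pair_wf_digraph T by fact
  \<comment> \<open>The copy of T is its image under the isomorphism acting as \<open>\<phi>\<close>
    on vertices and componentwise on arcs.\<close>
  let ?hom = "\<lparr>iso_verts = \<phi>, iso_arcs = map_prod \<phi> \<phi>, iso_head = snd, iso_tail = fst\<rparr>"
  have sub: "parcs T \<subseteq> pverts T \<times> pverts T" using T.in_arcsD1 T.in_arcsD2 by auto
  have iso: "pre_digraph.digraph_isomorphism (with_proj T) ?hom"
    unfolding pre_digraph.digraph_isomorphism_def
    using T.wf_digraph inj_on_subset[OF map_prod_inj_on[OF inj inj] sub] inj by auto
  have "subgraph (app_iso ?hom (with_proj T)) (with_proj G)"
    unfolding subgraph_def
  proof (intro conjI)
    show "wf_digraph (with_proj G)" using G by (simp add: wf_digraph_wp_iff)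
    show "wf_digraph (app_iso ?hom (with_proj T))"
      using T.in_arcsD1 T.in_arcsD2 by unfold_locales auto
  qed (use verts arcs in \<open>auto simp: compatible_def\<close>)
  then show ?thesis using iso unfolding contains_subgraph_def digraph_iso_def by blast
qed

text \<open>Vertices are renamed to their positions in a list sorted by non-increasing
  degree.\<close>

lemma realizes_of_realization:
  assumes "realization (with_proj G) \<pi>" "sorted_wrt (\<ge>) \<pi>"
  obtains E where "realizes {..<length \<pi>} ((!) \<pi>) E"
proof -
  have G: "graph (with_proj G)"
    and deg: "image_mset (out_degree (with_proj G)) (mset_set (pverts G)) = mset \<pi>"
    using assms(1) by (auto simp: realization_def)
  have S: "simple_graph_on (pverts G) (parcs G)" using graph_simple_graph_on[OF G] by simp
  note D = simple_graph_onD[OF S]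
  define dg where "dg v = card (parcs G `` {v})" for v
  have od: "out_degree (with_proj G) = dg" using graph_out_degree[OF G] by (auto simp: dg_def)
  obtain vs where vs: "set vs = pverts G" "distinct vs" using finite_distinct_list D(1) by blast
  define us where "us = rev (sort_key dg vs)"
  have us: "set us = pverts G" "distinct us" using vs by (auto simp: us_def)
  have "map dg us = \<pi>"
  proof -
    have "mset (map dg (sort_key dg vs)) = mset (rev \<pi>)"
      using deg od vs by (simp add: mset_set_set[symmetric])
    moreover have "sorted (map dg (sort_key dg vs))" by simp
    moreover have "sorted (rev \<pi>)" using assms(2) by (simp add: sorted_wrt_rev)
    ultimately have "map dg (sort_key dg vs) = rev \<pi>"
      by (metis properties_for_sort)
    then show ?thesis by (simp add: us_def rev_map[symmetric])
  qed
  then have len: "length us = length \<pi>" and nth: "\<And>i. i < length \<pi> \<Longrightarrow> dg (us ! i) = \<pi> ! i"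
    by (metis length_map, metis length_map nth_map)
  define E where "E = {(i, k). i < length \<pi> \<and> k < length \<pi> \<and> (us ! i, us ! k) \<in> parcs G}"
  have "simple_graph_on {..<length \<pi>} E"
    using D(7,8) by (auto simp: simple_graph_on_def E_def sym_def irrefl_def)
  moreover have "card (E `` {i}) = \<pi> ! i" if i: "i < length \<pi>" for i
  proof -
    have bij: "bij_betw ((!) us) {..<length \<pi>} (pverts G)"
      using us len by (intro bij_betw_nth) auto
    have "(!) us ` (E `` {i}) = parcs G `` {us ! i}"
    proof
      show "(!) us ` (E `` {i}) \<subseteq> parcs G `` {us ! i}" by (auto simp: E_def)
      show "parcs G `` {us ! i} \<subseteq> (!) us ` (E `` {i})"
      proof
        fix w assume w: "w \<in> parcs G `` {us ! i}"
        then have "w \<in> pverts G" using D(9) by blast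
        then obtain k where "k < length \<pi>" "w = us ! k" using bij by (auto simp: bij_betw_def)
        then show "w \<in> (!) us ` (E `` {i})" using w i by (auto simp: E_def)
      qed
    qed
    moreover have "inj_on ((!) us) (E `` {i})"
      using bij by (auto simp: bij_betw_def E_def intro: inj_on_subset)
    ultimately show ?thesis using nth[OF i] by (metis card_image dg_def)
  qed
  ultimately show thesis by (intro that[of E]) (auto simp: realizes_def)
qed

lemma realization_of_realizes:
  assumes "realizes {..<length \<pi>} ((!) \<pi>) E"
  shows "realization (with_proj \<lparr>pverts = {..<length \<pi>}, parcs = E\<rparr>) \<pi>"
    "pair_wf_digraph \<lparr>pverts = {..<length \<pi>}, parcs = E\<rparr>"
proof -
  let ?G = "\<lparr>pverts = {..<length \<pi>}, parcs = E\<rparr>"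
  have S: "simple_graph_on {..<length \<pi>} E" using assms by (simp add: realizes_def)
  note D = simple_graph_onD[OF S]
  have "pair_graph ?G"
    using D by unfold_locales (force simp: symmetric_def)+
  then have G: "graph (with_proj ?G)" by (rule pair_graph.pair_graphD_graph)
  then show "pair_wf_digraph ?G" by (simp add: graph_def digraph_def fin_digraph_def wf_digraph_wp_iff)
  have "image_mset (out_degree (with_proj ?G)) (mset_set {..<length \<pi>}) = image_mset ((!) \<pi>) (mset_set {..<length \<pi>})"
    using assms graph_out_degree[OF G] by (intro image_mset_cong) (auto simp: realizes_def)
  also have "\<dots> = mset (map ((!) \<pi>) [0..<length \<pi>])"
    by (simp add: atLeast0LessThan[symmetric])
  also have "\<dots> = mset \<pi>" by (simp add: map_nth)
  finally show "realization (with_proj ?G) \<pi>" using G by (simp add: realization_def)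
qed

theorem theorem4p1:
  fixes t n :: nat and \<pi> :: "nat list"
  assumes "t \<ge> 2"
    and "int n \<ge> 20 * (int t)\<^sup>2 - int t"
    and "length \<pi> = n"
    and "graphic \<pi>"
    and "int (sum_list \<pi>) > 4 * int t * int n - 2 * int n - 4 * (int t)\<^sup>2 + 2 * int t"
  shows "\<exists>G :: nat pair_pre_digraph. realization (with_proj G) \<pi> \<and>
    (\<forall>T :: nat pair_pre_digraph. two_tree (with_proj T) \<and> card (pverts T) = 3 * t \<longrightarrow>
      contains_subgraph (with_proj G) (with_proj T))"
proof -
  obtain G0 :: "nat pair_pre_digraph" where G0: "realization (with_proj G0) \<pi>" and sorted: "sorted_wrt (\<ge>) \<pi>"
    using assms(4) by (auto simp: graphic_def)
  obtain E0 where E0: "realizes {..<n} ((!) \<pi>) E0"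
    using realizes_of_realization[OF G0 sorted] assms(3) by blast
  have "dense_sequence n t ((!) \<pi>)"
  proof
    show "2 \<le> t" by (rule assms(1))
    have "int (20 * t\<^sup>2) \<le> int (n + t)" using assms(2) by simp
    then show "20 * t\<^sup>2 \<le> n + t" by (simp only: of_nat_le_iff)
    show "\<pi> ! k \<le> \<pi> ! i" if "i \<le> k" "k < n" for i k
      using sorted_wrt_nth_less[OF sorted, of i k] that assms(3) by (cases "i = k") auto
    have "sum_list \<pi> = (\<Sum>i<n. \<pi> ! i)" using assms(3) by (simp add: sum_list_sum_nth atLeast0LessThan)
    then have "int (4 * t * n + 2 * t) < int ((\<Sum>i<n. \<pi> ! i) + 2 * n + 4 * t\<^sup>2)"
      using assms(5) by (simp del: of_nat_sum)
    then show "4 * t * n + 2 * t < (\<Sum>i<n. \<pi> ! i) + 2 * n + 4 * t\<^sup>2" by (simp only: of_nat_less_iff)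
  qed
  then obtain E f where E: "realizes {..<n} ((!) \<pi>) E"
    and f: "inj_on f {..<3 * t}" "f ` {..<3 * t} \<subseteq> {..<n}"
    and univ: "(\<forall>(i, k) \<in> hub_join t. (f i, f k) \<in> E) \<or>
      (\<exists>j. 2 \<le> j \<and> j \<le> t \<and> (\<forall>(i, k) \<in> cocktail_join t j. (f i, f k) \<in> E))"
    using E0 by (rule dense_sequence.ex_universal_realization)
  \<comment> \<open>j and E are fixed before any 2-tree is considered, so one realization serves
    them all.\<close>
  obtain j where j: "1 \<le> j" "j \<le> t"
    and emb: "\<And>i k. (i, k) \<in> (if j = 1 then hub_join t else cocktail_join t j) \<Longrightarrow> (f i, f k) \<in> E"
  proof -
    from univ show thesis
    proof
      assume "\<forall>(i, k) \<in> hub_join t. (f i, f k) \<in> E"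
      then show thesis using assms(1) by (intro that[of 1]) auto
    next
      assume "\<exists>j. 2 \<le> j \<and> j \<le> t \<and> (\<forall>(i, k) \<in> cocktail_join t j. (f i, f k) \<in> E)"
      then obtain j where "2 \<le> j" "j \<le> t" "\<forall>(i, k) \<in> cocktail_join t j. (f i, f k) \<in> E" by blast
      then show thesis by (intro that[of j]) auto
    qed
  qed
  let ?G = "\<lparr>pverts = {..<n}, parcs = E\<rparr>"
  have G: "realization (with_proj ?G) \<pi>" "pair_wf_digraph ?G"
    using realization_of_realizes[of \<pi> E] E assms(3) by auto
  have "contains_subgraph (with_proj ?G) (with_proj T)"
    if T: "two_tree (with_proj T)" "card (pverts T) = 3 * t" for T :: "nat pair_pre_digraph"
  proof -
    obtain c where S: "simple_graph_on (pverts T) (parcs T)" and c: "forest_colouring (pverts T) (parcs T) c"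
      using two_tree_forest_colouring[OF T(1)] by auto
    obtain A B C where "forest_classes (parcs T) (pverts T) A B C"
      using forest_colouring_forest_classes[OF S c] by blast
    then obtain g where g: "bij_betw g {..<3 * t} (pverts T)"
      and arcs: "\<And>i k. i < 3 * t \<Longrightarrow> k < 3 * t \<Longrightarrow> (g i, g k) \<in> parcs T \<Longrightarrow>
        (i, k) \<in> (if j = 1 then hub_join t else cocktail_join t j)"
      using forest_classes.ex_ordering[OF _ T(2) j] by blast
    \<comment> \<open>A vertex of T goes to its position in the ordering and from there by f into
      the realization.\<close>
    define h where "h = inv_into {..<3 * t} g"
    have h: "bij_betw h (pverts T) {..<3 * t}" "\<And>x. x \<in> pverts T \<Longrightarrow> g (h x) = x"
      using g by (auto simp: h_def bij_betw_inv_into bij_betw_inv_into_right)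
    show ?thesis
    proof (rule contains_subgraph_pairI[where \<phi> = "f \<circ> h"])
      show "pair_wf_digraph T" using simple_graph_onD(9)[OF S] by unfold_locales auto
      show "inj_on (f \<circ> h) (pverts T)" using h(1) f(1) by (auto simp: bij_betw_def comp_inj_on)
      show "(f \<circ> h) ` pverts T \<subseteq> pverts ?G" using h(1) f(2) by (auto simp: bij_betw_def)
      fix x y assume xy: "(x, y) \<in> parcs T"
      then have V: "x \<in> pverts T" "y \<in> pverts T" using simple_graph_onD(9)[OF S] by auto
      then have "h x < 3 * t" "h y < 3 * t" using h(1) by (auto simp: bij_betw_def)
      then show "((f \<circ> h) x, (f \<circ> h) y) \<in> parcs ?G"
        using arcs[of "h x" "h y"] emb xy h(2) V by auto
    qed (rule G(2))
  qed
  with G(1) show ?thesis by blast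
qed

end
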